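(* Let $d\geqslant 3$ be an integer, and let $\Pi(d)\subset PM(d)$ be the unicritical stratum, i.e. the set of primitive majors of degree $d$ consisting of a single ideal $d$-gon. The set of all $M\in\Pi(d)$ at which the restriction of core entropy $h|_{\Pi(d)}:\Pi(d)\to\mathbb{R}$ attains its maximum over $\Pi(d)$ is a Cantor set (i.e. it is homeomorphic to the standard middle-thirds Cantor set).
   Context: Identify the unit circle $S^1=\partial\mathbb{D}$ with $[0,1)=\mathbb{R}/\mathbb{Z}$ and let $T(x)=dx\bmod 1$. Primitive majors. A primitive major of degree $d$ is a finite set $M=\{L_1,\dots,L_r\}$ of ideal polygons (called leaves; an ideal line, with two endpoints, is allowed) in the closed unit disc such that: (1) the leaves are pairwise disjoint (including their endpoints); (2) for each $j$, all endpoints $\partial L_j:=\partial\mathbb{D}\cap L_j$ of $L_j$ have the same image under $T$ (this common image is denoted $T(L_j)$, and $T^n(L_j):=T^{n-1}(T(L_j))$ for $n\geqslant 1$); (3) $\sum_{j=1}^r(|\partial\mathbb{D}\cap L_j|-1)=d-1$. $PM(d)$ is the set of all primitive majors of degree $d$, and $RPM(d)\subset PM(d)$ is the subset of rational primitive majors, i.e. those all of whose leaves have rational endpoints. The elements of $\Pi(d)$ are exactly the $M_a=\{(a,a+\frac1d,\dots,a+\frac{d-1}{d})\}$, where the single leaf is the ideal polygon with these endpoints (mod $1$), and $M_a=M_{a+1/d}$. Topology on $PM(d)$. For $M\in PM(d)$ let $\delta_M$ be the largest pseudometric on $S^1$ that is bounded above by arc-length distance and for which any two endpoints of a common leaf of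 $M$ are at distance $0$. $PM(d)$ carries the metric $\mathrm{dist}(M,M')=\sup_{x,y\in S^1}|\delta_M(x,y)-\delta_{M'}(x,y)|$; $RPM(d)$ is dense in it. $\Pi(d)$ has the subspace topology; via $a\mapsto M_a$ it is homeomorphic to the circle $\mathbb{R}/\frac1d\mathbb{Z}$. Separation. A leaf $L_j$ separates $x,y\in S^1$ if $x$ and $y$ lie in different connected components of $S^1\setminus\partial L_j$. The separation vector of an ordered pair $(x,y)$ is $(L_{a_1},\dots,L_{a_s})$, the list of all leaves of $M$ separating $x$ from $y$, in the order in which they are crossed by the geodesic from $x$ to $y$; it is $\emptyset$ if no leaf separates them. Thurston graph. Let $P=\{T^i(L_j): i\geqslant 1,\ 1\leqslant j\leqslant r\}$. The directed graph $G(M)$ (multiple edges counted with multiplicity) has as vertices the unordered pairs $\{x,y\}$ with $x,y\in P$ (possibly $x=y$). If $x\neq y$ are endpoints of a common leaf, $\{x,y\}$ has no outgoing edges. Otherwise, if no leaf separates $x$ and $y$, there is exactly one outgoing edge, to $\{T(x),T(y)\}$. Otherwise, if $(x,y)$ has separation vector $(L_{a_1},\dots,L_{a_s})$ with $s\geqslant 1$, there are $s+1$ outgoing edges: to $\{T(x),T(L_{a_1})\}$, to $\{T(L_{a_i}),T(L_{a_{i+1}})\}$ for $1\leqslant i\leqslant s-1$, and to $\{T(L_{a_s}),T(y)\}$. Core entropy. For $m\in RPM(d)$ the graph $G(m)$ is finite; let $\rho(m)$ be the leading eigenvalue (spectral radius) of its adjacency matrix and set $h(m)=\log\rho(m)$.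 By known results of Tiozzo and Gao–Tiozzo, $h$ extends uniquely to a continuous function $h:PM(d)\to\mathbb{R}$, called core entropy. *)

theory Defs
  imports
    "HOL-Analysis.Analysis"
    "Jordan_Normal_Form.Spectral_Radius"
begin

section \<open>The circle and primitive majors\<close>

text \<open>
  The circle \<open>\<real>/\<int>\<close> is represented by its fundamental domain \<open>[0,1)\<close>; \<open>circle_point\<close> is the
  identification with the boundary of the closed unit disc.
\<close>

definition circle :: "real set" where
  "circle = {0..<1}"

definition circle_point :: "real \<Rightarrow> complex" where
  "circle_point x = cis (2 * pi * x)"

definition circle_map :: "nat \<Rightarrow> real \<Rightarrow> real" where
  "circle_map d x = frac (real d * x)"

text \<open>
  A leaf is represented by its set of endpoints. Hyperbolic geodesics are taken in the projective
  (Klein) model of the disc, where they are straight chords, so that the ideal polygon spanned by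
  a set of endpoints is a convex hull.
\<close>

definition ideal_polygon :: "real set \<Rightarrow> complex set" where
  "ideal_polygon L = convex hull (circle_point ` L)"

definition primitive_majors :: "nat \<Rightarrow> real set set set" where
  "primitive_majors d =
    {M. finite M
      \<and> (\<forall>L\<in>M. L \<subseteq> circle \<and> finite L \<and> card L \<ge> 2)
      \<and> (\<forall>L\<in>M. \<forall>L'\<in>M. L \<noteq> L' \<longrightarrow> ideal_polygon L \<inter> ideal_polygon L' = {})
      \<and> (\<forall>L\<in>M. \<forall>x\<in>L. \<forall>y\<in>L. circle_map d x = circle_map d y)
      \<and> (\<Sum>L\<in>M. card L - 1) = d - 1}"

definition rational_primitive_majors :: "nat \<Rightarrow> real set set set" where
  "rational_primitive_majors d = {M \<in> primitive_majors d. \<forall>L\<in>M. L \<subseteq> \<rat>}"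

definition unicritical_majors :: "nat \<Rightarrow> real set set set" where
  "unicritical_majors d = {M \<in> primitive_majors d. \<exists>L. M = {L} \<and> card L = d}"


section \<open>The metric on primitive majors\<close>

text \<open>Arc length, normalised so that the circle has length 1.\<close>

definition arc_dist :: "real \<Rightarrow> real \<Rightarrow> real" where
  "arc_dist x y = min \<bar>x - y\<bar> (1 - \<bar>x - y\<bar>)"

definition pseudometric_on :: "'a set \<Rightarrow> ('a \<Rightarrow> 'a \<Rightarrow> real) \<Rightarrow> bool" where
  "pseudometric_on S \<delta> \<longleftrightarrow>
    (\<forall>x\<in>S. \<delta> x x = 0) \<and>
    (\<forall>x\<in>S. \<forall>y\<in>S. 0 \<le> \<delta> x y \<and> \<delta> x y = \<delta> y x) \<and>
    (\<forall>x\<in>S. \<forall>y\<in>S. \<forall>z\<in>S. \<delta> x z \<le> \<delta> x y + \<delta> y z)"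

definition admissible_pseudometrics :: "real set set \<Rightarrow> (real \<Rightarrow> real \<Rightarrow> real) set" where
  "admissible_pseudometrics M =
    {\<delta>. pseudometric_on circle \<delta>
      \<and> (\<forall>x\<in>circle. \<forall>y\<in>circle. \<delta> x y \<le> arc_dist x y)
      \<and> (\<forall>L\<in>M. \<forall>x\<in>L. \<forall>y\<in>L. \<delta> x y = 0)}"

text \<open>
  The pointwise supremum is the largest admissible pseudometric; see \<open>major_pseudometric_admissible\<close>
  and \<open>major_pseudometric_upper\<close> below.
\<close>

definition major_pseudometric :: "real set set \<Rightarrow> real \<Rightarrow> real \<Rightarrow> real" where
  "major_pseudometric M x y = (SUP \<delta>\<in>admissible_pseudometrics M. \<delta> x y)"

definition major_dist :: "real set set \<Rightarrow> real set set \<Rightarrow> real" where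
  "major_dist M M' =
    (SUP (x, y)\<in>circle \<times> circle. \<bar>major_pseudometric M x y - major_pseudometric M' x y\<bar>)"

definition majors_topology :: "nat \<Rightarrow> real set set topology" where
  "majors_topology d = Metric_space.mtopology (primitive_majors d) major_dist"


section \<open>Separation and the Thurston graph\<close>

definition separates :: "real set \<Rightarrow> real \<Rightarrow> real \<Rightarrow> bool" where
  "separates L x y \<longleftrightarrow>
    (let C = sphere 0 1 - circle_point ` L in
      circle_point x \<in> C \<and> circle_point y \<in> C \<and>
      \<not> connected_component C (circle_point x) (circle_point y))"

text \<open>
  The list is unique for a primitive major: every separating polygon meets the chord from \<open>x\<close> to
  \<open>y\<close> in a nonempty segment, and these segments are disjoint.
\<close>

definition separation_vector :: "real set set \<Rightarrow> real \<Rightarrow> real \<Rightarrow> real set list" where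
  "separation_vector M x y =
    (THE Ls. distinct Ls \<and> set Ls = {L\<in>M. separates L x y} \<and>
      sorted_wrt (\<lambda>L L'.
        \<forall>p \<in> ideal_polygon L \<inter> closed_segment (circle_point x) (circle_point y).
        \<forall>q \<in> ideal_polygon L' \<inter> closed_segment (circle_point x) (circle_point y).
          dist (circle_point x) p < dist (circle_point x) q) Ls)"

definition leaf_image :: "nat \<Rightarrow> real set \<Rightarrow> real" where
  "leaf_image d L = the_elem (circle_map d ` L)"

definition postcritical_set :: "nat \<Rightarrow> real set set \<Rightarrow> real set" where
  "postcritical_set d M = {(circle_map d ^^ n) (leaf_image d L) | n L. L \<in> M}"

definition thurston_vertices :: "nat \<Rightarrow> real set set \<Rightarrow> real set set" where
  "thurston_vertices d M = {{x, y} | x y. x \<in> postcritical_set d M \<and> y \<in> postcritical_set d M}"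

text \<open>
  Targets of the edges leaving a vertex, with multiplicity. The vertex \<open>v = {x, y}\<close> is oriented
  from its smaller to its larger element (which coincide for \<open>x = y\<close>); the opposite orientation
  reverses the separation vector and yields the same targets. For an empty separation vector the
  list is \<open>[{T x, T y}]\<close>.
\<close>

definition thurston_edges :: "nat \<Rightarrow> real set set \<Rightarrow> real set \<Rightarrow> real set list" where
  "thurston_edges d M v =
    (let x = Min v; y = Max v in
      if x \<noteq> y \<and> (\<exists>L\<in>M. x \<in> L \<and> y \<in> L) then []
      else
        let ts = circle_map d x # map (leaf_image d) (separation_vector M x y) @ [circle_map d y]
        in map (\<lambda>(a, b). {a, b}) (zip ts (tl ts)))"

text \<open>The spectral radius does not depend on the chosen enumeration of the vertices.\<close>

definition thurston_matrix :: "nat \<Rightarrow> real set set \<Rightarrow> complex Matrix.mat" where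
  "thurston_matrix d M =
    (let vs = (SOME vs. distinct vs \<and> set vs = thurston_vertices d M) in
      Matrix.mat (length vs) (length vs)
        (\<lambda>(i, j). of_nat (count_list (thurston_edges d M (vs ! i)) (vs ! j))))"


section \<open>Core entropy\<close>

definition rational_core_entropy :: "nat \<Rightarrow> real set set \<Rightarrow> real" where
  "rational_core_entropy d m = ln (spectral_radius (thurston_matrix d m))"

text \<open>
  Core entropy is the unique continuous extension of the above to all primitive majors; the
  following predicate says that \<open>h\<close> is this extension.
\<close>

definition is_core_entropy :: "nat \<Rightarrow> (real set set \<Rightarrow> real) \<Rightarrow> bool" where
  "is_core_entropy d h \<longleftrightarrow>
    continuous_map (majors_topology d) euclideanreal h \<and>
    (\<forall>m\<in>rational_primitive_majors d. h m = rational_core_entropy d m)"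


section \<open>The middle-thirds Cantor set\<close>

primrec cantor_stage :: "nat \<Rightarrow> real set" where
  "cantor_stage 0 = {0..1}"
| "cantor_stage (Suc n) = (\<lambda>x. x / 3) ` cantor_stage n \<union> (\<lambda>x. (2 + x) / 3) ` cantor_stage n"

definition cantor_set :: "real set" where
  "cantor_set = (\<Inter>n. cantor_stage n)"


section \<open>The metric space of primitive majors is well defined\<close>

lemma arc_dist_triangle:
  assumes "x \<in> circle" "y \<in> circle" "z \<in> circle"
  shows "arc_dist x z \<le> arc_dist x y + arc_dist y z"
  using assms by (auto simp: arc_dist_def circle_def min_def abs_if split: if_splits)

lemma arc_dist_commute: "arc_dist x y = arc_dist y x"
  by (simp add: arc_dist_def abs_minus_commute)

lemma arc_dist_nonneg: "x \<in> circle \<Longrightarrow> y \<in> circle \<Longrightarrow> 0 \<le> arc_dist x y"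
  by (auto simp: arc_dist_def circle_def)

lemma arc_dist_eq_0: "x \<in> circle \<Longrightarrow> y \<in> circle \<Longrightarrow> arc_dist x y = 0 \<longleftrightarrow> x = y"
  by (auto simp: arc_dist_def circle_def min_def split: if_splits)

lemma arc_dist_le: "arc_dist x y \<le> 1/2"
  by (simp add: arc_dist_def min_def)

lemma zero_admissible: "(\<lambda>_ _. 0) \<in> admissible_pseudometrics M"
  by (auto simp: admissible_pseudometrics_def pseudometric_on_def arc_dist_nonneg)

lemma admissible_bdd:
  assumes "x \<in> circle" "y \<in> circle"
  shows "bdd_above ((\<lambda>\<delta>. \<delta> x y) ` admissible_pseudometrics M)"
  using assms by (intro bdd_aboveI2[of _ _ "arc_dist x y"]) (auto simp: admissible_pseudometrics_def)

lemma major_pseudometric_upper: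
  assumes "\<delta> \<in> admissible_pseudometrics M" "x \<in> circle" "y \<in> circle"
  shows "\<delta> x y \<le> major_pseudometric M x y"
  unfolding major_pseudometric_def
  by (rule cSUP_upper[OF assms(1) admissible_bdd[OF assms(2,3)]])

lemma major_pseudometric_least:
  assumes "\<And>\<delta>. \<delta> \<in> admissible_pseudometrics M \<Longrightarrow> \<delta> x y \<le> c"
  shows "major_pseudometric M x y \<le> c"
  unfolding major_pseudometric_def
  using zero_admissible by (intro cSUP_least assms) auto

lemma major_pseudometric_admissible:
  assumes "\<Union>M \<subseteq> circle"
  shows "major_pseudometric M \<in> admissible_pseudometrics M"
proof -
  let ?D = "major_pseudometric M"
  have ge0: "0 \<le> ?D x y" if "x \<in> circle" "y \<in> circle" for x y
    using major_pseudometric_upper[OF zero_admissible that] .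
  have le: "?D x y \<le> arc_dist x y" if "x \<in> circle" "y \<in> circle" for x y
    using that by (intro major_pseudometric_least) (auto simp: admissible_pseudometrics_def)
  have refl: "?D x x = 0" if "x \<in> circle" for x
    using ge0[OF that that] le[OF that that] arc_dist_eq_0[OF that that] by simp
  have leaf: "?D x y = 0" if "L \<in> M" "x \<in> L" "y \<in> L" for L x y
  proof (rule antisym)
    show "?D x y \<le> 0"
      using that by (intro major_pseudometric_least) (auto simp: admissible_pseudometrics_def)
    show "0 \<le> ?D x y"
      using assms that by (intro ge0) auto
  qed
  have sym_le: "?D x y \<le> ?D y x" if "x \<in> circle" "y \<in> circle" for x y
  proof (rule major_pseudometric_least)
    fix \<delta> assume \<delta>: "\<delta> \<in> admissible_pseudometrics M"
    hence "\<delta> x y = \<delta> y x"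
      using that by (auto simp: admissible_pseudometrics_def pseudometric_on_def)
    thus "\<delta> x y \<le> ?D y x"
      using major_pseudometric_upper[OF \<delta> that(2,1)] by simp
  qed
  have triangle: "?D x z \<le> ?D x y + ?D y z" if "x \<in> circle" "y \<in> circle" "z \<in> circle" for x y z
  proof (rule major_pseudometric_least)
    fix \<delta> assume \<delta>: "\<delta> \<in> admissible_pseudometrics M"
    hence "\<delta> x z \<le> \<delta> x y + \<delta> y z"
      using that by (auto simp: admissible_pseudometrics_def pseudometric_on_def)
    thus "\<delta> x z \<le> ?D x y + ?D y z"
      using major_pseudometric_upper[OF \<delta> that(1,2)] major_pseudometric_upper[OF \<delta> that(2,3)]
      by simp
  qed
  show ?thesis
    using ge0 le refl leaf sym_le triangle
    by (auto simp: admissible_pseudometrics_def pseudometric_on_def intro: antisym)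
qed

lemma major_pseudometric_bounds:
  assumes "x \<in> circle" "y \<in> circle"
  shows "0 \<le> major_pseudometric M x y" "major_pseudometric M x y \<le> 1/2"
proof -
  show "0 \<le> major_pseudometric M x y"
    using major_pseudometric_upper[OF zero_admissible assms] .
  have "major_pseudometric M x y \<le> arc_dist x y"
    using assms by (intro major_pseudometric_least) (auto simp: admissible_pseudometrics_def)
  thus "major_pseudometric M x y \<le> 1/2"
    using arc_dist_le[of x y] by simp
qed

lemma primitive_majors_leaf:
  assumes "M \<in> primitive_majors d" "L \<in> M"
  shows "L \<subseteq> circle" "finite L" "card L \<ge> 2"
  using assms by (auto simp: primitive_majors_def)

lemma primitive_majors_leaf_unique:
  assumes "M \<in> primitive_majors d" "L \<in> M" "L' \<in> M" "x \<in> L" "x \<in> L'"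
  shows "L = L'"
proof (rule ccontr)
  assume "L \<noteq> L'"
  hence "ideal_polygon L \<inter> ideal_polygon L' = {}"
    using assms by (auto simp: primitive_majors_def)
  moreover have "circle_point x \<in> ideal_polygon L" "circle_point x \<in> ideal_polygon L'"
    using assms by (auto simp: ideal_polygon_def intro!: hull_inc)
  ultimately show False by blast
qed

lemma major_pseudometric_eq_0:
  assumes M: "M \<in> primitive_majors d" and x: "x \<in> circle" and y: "y \<in> circle"
  shows "major_pseudometric M x y = 0 \<longleftrightarrow> x = y \<or> (\<exists>L\<in>M. x \<in> L \<and> y \<in> L)"
proof
  assume "x = y \<or> (\<exists>L\<in>M. x \<in> L \<and> y \<in> L)"
  moreover have "\<Union>M \<subseteq> circle"
    using primitive_majors_leaf[OF M] by blast
  ultimately show "major_pseudometric M x y = 0"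
    using major_pseudometric_admissible[of M] x
    by (auto simp: admissible_pseudometrics_def pseudometric_on_def)
next
  assume eq0: "major_pseudometric M x y = 0"
  show "x = y \<or> (\<exists>L\<in>M. x \<in> L \<and> y \<in> L)"
  proof (rule ccontr)
    assume ncon: "\<not> ?thesis"
    define A where "A = insert x (\<Union>{L\<in>M. x \<in> L})"
    define B where "B = insert y (\<Union>M) - A"
    have finM: "finite M"
      using M by (simp add: primitive_majors_def)
    have finA: "finite A" and finB: "finite B"
      using finM primitive_majors_leaf(2)[OF M] by (auto simp: A_def B_def)
    have AS: "A \<subseteq> circle" and BS: "B \<subseteq> circle"
      using x y primitive_majors_leaf(1)[OF M] by (auto simp: A_def B_def)
    have yB: "y \<in> B" and xA: "x \<in> A"
      using ncon by (auto simp: A_def B_def)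
    define f where "f = (\<lambda>u. Min ((\<lambda>a. arc_dist a u) ` A))"
    define e where "e = Min (f ` B)"
    define g where "g = (\<lambda>u. min (f u) e)"
    have f_le: "f u \<le> arc_dist a u" if "a \<in> A" for a u
      unfolding f_def using finA that by (intro Min_le) auto
    have f_mem: "\<exists>a\<in>A. f u = arc_dist a u" for u
    proof -
      have "f u \<in> (\<lambda>a. arc_dist a u) ` A"
        unfolding f_def using finA xA by (intro Min_in) auto
      thus ?thesis by auto
    qed
    have f_lip: "f u \<le> f v + arc_dist u v" if uv: "u \<in> circle" "v \<in> circle" for u v
    proof -
      obtain a where a: "a \<in> A" "f v = arc_dist a v"
        using f_mem by blast
      have "f u \<le> arc_dist a u"
        using f_le a by blast
      also have "\<dots> \<le> arc_dist a v + arc_dist v u"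
        using a AS uv by (intro arc_dist_triangle) auto
      finally show ?thesis
        using a arc_dist_commute[of u v] by simp
    qed
    have f_nonneg: "0 \<le> f u" if "u \<in> circle" for u
    proof -
      obtain a where a: "a \<in> A" "f u = arc_dist a u"
        using f_mem by blast
      hence "a \<in> circle"
        using AS by blast
      thus ?thesis
        using arc_dist_nonneg[OF _ that] a by simp
    qed
    have f_A: "f u = 0" if "u \<in> A" for u
      using f_le[OF that, of u] f_nonneg[of u] AS that arc_dist_eq_0[of u u] by auto
    have f_B: "f u > 0" if "u \<in> B" for u
    proof -
      obtain a where a: "a \<in> A" "f u = arc_dist a u"
        using f_mem by blast
      have "a \<in> circle" "u \<in> circle" "a \<noteq> u"
        using a that AS BS by (auto simp: B_def)
      thus ?thesis
        using a arc_dist_eq_0[of a u] arc_dist_nonneg[of a u] by linarith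
    qed
    have e_pos: "e > 0"
      unfolding e_def using finB yB f_B by (subst Min_gr_iff) auto
    have g_A: "g u = 0" if "u \<in> A" for u
      using f_A[OF that] e_pos by (simp add: g_def)
    have g_B: "g u = e" if "u \<in> B" for u
      using finB that by (auto simp: g_def e_def intro!: min_absorb2 Min_le)
    have leaf: "g u = g v" if L: "L \<in> M" "u \<in> L" "v \<in> L" for L u v
    proof (cases "u \<in> A \<or> v \<in> A")
      case True
      then obtain w where "w \<in> L" "w \<in> A"
        using L by auto
      hence "x \<in> L"
        using L primitive_majors_leaf_unique[OF M] by (auto simp: A_def)
      hence "u \<in> A" "v \<in> A"
        using L by (auto simp: A_def)
      thus ?thesis by (simp add: g_A)
    next
      case False
      hence "u \<in> B" "v \<in> B"
        using L by (auto simp: B_def)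
      thus ?thesis by (simp add: g_B)
    qed
    have lip: "\<bar>g u - g v\<bar> \<le> arc_dist u v" if "u \<in> circle" "v \<in> circle" for u v
      using f_lip[OF that] f_lip[OF that(2,1)] arc_dist_commute[of u v] arc_dist_nonneg[OF that]
      unfolding g_def by linarith
    have "\<forall>L\<in>M. \<forall>u\<in>L. \<forall>v\<in>L. \<bar>g u - g v\<bar> = 0"
    proof (intro ballI)
      fix L u v assume "L \<in> M" "u \<in> L" "v \<in> L"
      from leaf[OF this] show "\<bar>g u - g v\<bar> = 0" by simp
    qed
    moreover have "pseudometric_on circle (\<lambda>u v. \<bar>g u - g v\<bar>)"
      by (auto simp: pseudometric_on_def)
    ultimately have "(\<lambda>u v. \<bar>g u - g v\<bar>) \<in> admissible_pseudometrics M"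
      using lip unfolding admissible_pseudometrics_def by blast
    from major_pseudometric_upper[OF this x y] eq0 show False
      using g_A[OF xA] g_B[OF yB] e_pos by simp
  qed
qed

lemma major_dist_bdd:
  "bdd_above ((\<lambda>(x, y). \<bar>major_pseudometric M x y - major_pseudometric M' x y\<bar>) ` (circle \<times> circle))"
proof (rule bdd_aboveI2[of _ _ 1], clarify)
  fix x y assume "x \<in> circle" "y \<in> circle"
  thus "\<bar>major_pseudometric M x y - major_pseudometric M' x y\<bar> \<le> 1"
    using major_pseudometric_bounds[of x y M] major_pseudometric_bounds[of x y M'] by linarith
qed

lemma major_dist_upper:
  assumes "x \<in> circle" "y \<in> circle"
  shows "\<bar>major_pseudometric M x y - major_pseudometric M' x y\<bar> \<le> major_dist M M'"
  using cSUP_upper[OF _ major_dist_bdd, of "(x, y)" M M'] assms by (simp add: major_dist_def)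

lemma major_dist_least:
  assumes "\<And>x y. x \<in> circle \<Longrightarrow> y \<in> circle \<Longrightarrow>
    \<bar>major_pseudometric M x y - major_pseudometric M' x y\<bar> \<le> c"
  shows "major_dist M M' \<le> c"
proof -
  have "(0, 0) \<in> circle \<times> circle"
    by (simp add: circle_def)
  thus ?thesis
    unfolding major_dist_def using assms by (intro cSUP_least) auto
qed

lemma major_dist_eq_0_subset:
  assumes M: "M \<in> primitive_majors d" and M': "M' \<in> primitive_majors d"
    and eq: "major_dist M M' = 0"
  shows "M \<subseteq> M'"
proof
  fix L assume L: "L \<in> M"
  have same: "major_pseudometric M x y = major_pseudometric M' x y"
    if "x \<in> circle" "y \<in> circle" for x y
    using major_dist_upper[OF that, of M M'] eq by simp
  note LS = primitive_majors_leaf[OF M L]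
  obtain x y where xy: "x \<in> L" "y \<in> L" "x \<noteq> y"
  proof -
    have "\<not> card L \<le> Suc 0"
      using LS by simp
    thus ?thesis
      using that LS(2) by (auto simp: card_le_Suc0_iff_eq)
  qed
  have cls: "v \<in> L \<longleftrightarrow> v = x \<or> (\<exists>L'\<in>M'. x \<in> L' \<and> v \<in> L')" if "v \<in> circle" for v
  proof -
    have x: "x \<in> circle"
      using xy LS by blast
    have "v \<in> L \<longleftrightarrow> x = v \<or> (\<exists>L\<in>M. x \<in> L \<and> v \<in> L)"
      using L xy primitive_majors_leaf_unique[OF M] by blast
    thus ?thesis
      unfolding major_pseudometric_eq_0[OF M x that, symmetric] same[OF x that]
        major_pseudometric_eq_0[OF M' x that] by blast
  qed
  obtain L' where L': "L' \<in> M'" "x \<in> L'"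
    using cls[of y] xy LS by blast
  have "v \<in> L \<longleftrightarrow> v \<in> L'" for v
  proof (cases "v \<in> circle")
    case True
    thus ?thesis
      using cls[OF True] L' primitive_majors_leaf_unique[OF M' _ L'(1) _ L'(2)] by blast
  next
    case False
    thus ?thesis
      using LS(1) primitive_majors_leaf(1)[OF M' L'(1)] by blast
  qed
  hence "L = L'"
    by blast
  thus "L \<in> M'"
    using L'(1) by simp
qed

lemma Metric_space_primitive_majors: "Metric_space (primitive_majors d) major_dist"
proof
  have "0 \<in> circle"
    by (simp add: circle_def)
  thus nonneg: "0 \<le> major_dist M M'" for M M'
    using major_dist_upper[of 0 0 M M'] by simp
  show commute: "major_dist M M' = major_dist M' M" for M M'
    by (simp add: major_dist_def abs_minus_commute)
  show "major_dist M M' = 0 \<longleftrightarrow> M = M'"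
    if "M \<in> primitive_majors d" "M' \<in> primitive_majors d" for M M'
  proof
    assume "major_dist M M' = 0"
    thus "M = M'"
      using that commute[of M M'] major_dist_eq_0_subset[of M d M'] major_dist_eq_0_subset[of M' d M]
      by simp
  next
    assume "M = M'"
    moreover have "major_dist M M \<le> 0"
      by (rule major_dist_least) simp
    ultimately show "major_dist M M' = 0"
      using nonneg[of M M] by simp
  qed
  show "major_dist M1 M3 \<le> major_dist M1 M2 + major_dist M2 M3" for M1 M2 M3
  proof (rule major_dist_least)
    fix x y assume "x \<in> circle" "y \<in> circle"
    from major_dist_upper[OF this, of M1 M2] major_dist_upper[OF this, of M2 M3]
    show "\<bar>major_pseudometric M1 x y - major_pseudometric M3 x y\<bar>
        \<le> major_dist M1 M2 + major_dist M2 M3"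
      by linarith
  qed
qed

end

theory Submission
  imports Defs
begin

text \<open>
  A unicritical major is the regular \<open>d\<close>-gon \<open>critical_leaf d t\<close> of all preimages of one angle
  \<open>t\<close>, and \<open>t\<close> runs through the whole circle. Write \<open>x\<^sub>n\<close> for the \<open>n\<close>-th iterate of \<open>t\<close> under
  multiplication by \<open>d\<close>. As there is only one leaf, a vertex of the Thurston graph has at most two
  outgoing edges, so the core entropy is at most \<open>ln 2\<close>. The separated pair \<open>{x\<^sub>i, x\<^sub>j}\<close> has
  edges to \<open>{t, x\<^sub>i\<^sub>+\<^sub>1}\<close> and \<open>{t, x\<^sub>j\<^sub>+\<^sub>1}\<close>, hence everything depends on the pairs
  \<open>{t, x\<^sub>n}\<close> with \<open>n \<ge> 1\<close>.

  If all these pairs are separated, they span a subgraph in which every vertex has exactly two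
  outgoing edges, and the spectral radius is 2; an eigenfunction is the weight \<open>2^(-s)\<close>, where \<open>s\<close>
  is the time at which a pair is first separated (\<open>two_le_spectral_radius\<close>). If \<open>{t, x\<^sub>n}\<close> is not
  separated for some \<open>n \<ge> 1\<close>, then the walks from a vertex cannot branch at every step, since
  constant branching reaches this pair after \<open>n + 1\<close> steps. So fewer than \<open>2^(n + 2)\<close> walks of length
  \<open>n + 2\<close> start at any vertex (\<open>walk_count_deficient\<close>), and the entropy stays below \<open>ln 2\<close> by an amount
  that depends on \<open>n\<close> only. This uniformity carries the bound to irrational angles: they are not
  fixed by multiplication by \<open>d\<close>, so the same \<open>n\<close> serves for all nearby angles, and core entropy is
  continuous.

  It remains to find the angles whose orbit never returns to the sector of \<open>t\<close>. Rotation by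
  \<open>1/(d - 1)\<close> commutes with multiplication by \<open>d\<close>, so let \<open>0 < t < 1/(d - 1)\<close>. The sector of \<open>t\<close> is
  then \<open>(t/d, (t + 1)/d)\<close>; an orbit which avoids it lifts to the complementary interval, where the
  map takes the form \<open>y \<mapsto> d * y - k\<close> with \<open>1 \<le> k \<le> d - 1\<close>. The condition therefore says that \<open>t\<close>
  has a base \<open>d\<close> expansion \<open>0.0k\<^sub>1k\<^sub>2\<dots>\<close> without any further digit 0 (\<open>escaping_angle\<close>,
  \<open>maximizing_angle_separates\<close>). These numbers, together with their translates by multiples
  of \<open>1/(d - 1)\<close>, form a self-similar set. For \<open>d \<ge> 3\<close> it splits again and again into two disjoint
  compact parts of shrinking diameter, as the Cantor set does, so both are
  homeomorphic to the space of binary sequences (\<open>binary_splitting_homeomorphic\<close>). Finally,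
  \<open>t \<mapsto> {critical_leaf d t}\<close> is a continuous injection of a compact set of angles into a
  Hausdorff space.
\<close>

section \<open>Compact sets that split into two halves\<close>

primrec branch_state :: "('s \<Rightarrow> 's) \<Rightarrow> ('s \<Rightarrow> 's) \<Rightarrow> 's \<Rightarrow> (nat \<Rightarrow> bool) \<Rightarrow> nat \<Rightarrow> 's" where
  "branch_state l r s w 0 = s"
| "branch_state l r s w (Suc n) = (if w n then r (branch_state l r s w n) else l (branch_state l r s w n))"

abbreviation binary_sequences :: "(nat \<Rightarrow> bool) topology" where
  "binary_sequences \<equiv> product_topology (\<lambda>_. discrete_topology UNIV) UNIV"

lemma openin_cylinder:
  "openin binary_sequences {w'. \<forall>m<n. w' m = w m}"
proof (induction n)
  case 0
  have "{w'::nat \<Rightarrow> bool. \<forall>m<0. w' m = w m} = topspace binary_sequences"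
    by auto
  then show ?case
    by (metis openin_topspace)
next
  case (Suc n)
  have "openin binary_sequences {w' \<in> topspace binary_sequences. w' n \<in> {w n}}"
    by (rule openin_continuous_map_preimage[OF continuous_map_product_projection]) auto
  hence "openin binary_sequences ({w'. \<forall>m<n. w' m = w m} \<inter> {w'. w' n = w n})"
    using Suc by (intro openin_Int) auto
  moreover have "{w'. \<forall>m<n. w' m = w m} \<inter> {w'. w' n = w n} = {w'. \<forall>m<Suc n. w' m = w m}"
    by (auto simp: less_Suc_eq)
  ultimately show ?case by simp
qed

lemma branch_state_cong:
  "(\<And>m. m < n \<Longrightarrow> w m = w' m) \<Longrightarrow> branch_state l r s w n = branch_state l r s w' n"
  by (induction n) auto

text \<open>
  The sets \<open>piece s\<close> are the parts of a repeated binary splitting, described by states \<open>s\<close>. A binary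
  sequence prescribes at every level which half to enter; the pieces met on the way are nested,
  compact and nonempty, and their diameters tend to 0, so they shrink to one point. Sending the
  sequence to this point is a continuous bijection from a compact space. The weight \<open>V\<close> may exceed the diameter: it only needs to
  contract at every step, which the diameter itself need not do.
\<close>
theorem binary_splitting_homeomorphic:
  fixes piece :: "'s \<Rightarrow> real set" and left right :: "'s \<Rightarrow> 's" and V :: "'s \<Rightarrow> real" and q :: real
  assumes valid: "valid s0" "\<And>s. valid s \<Longrightarrow> valid (left s)" "\<And>s. valid s \<Longrightarrow> valid (right s)"
    and compact: "\<And>s. valid s \<Longrightarrow> compact (piece s)"
    and nonempty: "\<And>s. valid s \<Longrightarrow> piece s \<noteq> {}"
    and split: "\<And>s. valid s \<Longrightarrow> piece s = piece (left s) \<union> piece (right s)"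
    and disjoint: "\<And>s. valid s \<Longrightarrow> piece (left s) \<inter> piece (right s) = {}"
    and diam: "\<And>s x y. valid s \<Longrightarrow> x \<in> piece s \<Longrightarrow> y \<in> piece s \<Longrightarrow> \<bar>x - y\<bar> \<le> V s"
    and contract: "\<And>s. valid s \<Longrightarrow> V (left s) \<le> q * V s" "\<And>s. valid s \<Longrightarrow> V (right s) \<le> q * V s"
    and q: "0 \<le> q" "q < 1"
  shows "binary_sequences homeomorphic_space top_of_set (piece s0)"
proof -
  define P where "P w n = piece (branch_state left right s0 w n)" for w n
  have vn: "valid (branch_state left right s0 w n)" for w n
    by (induction n) (auto simp: valid)
  have P_Suc: "P w (Suc n) \<subseteq> P w n" for w n
    using split[OF vn[of w n]] by (auto simp: P_def)
  have P_0: "P w 0 = piece s0" for w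
    by (simp add: P_def)
  have P_mono: "P w n \<subseteq> P w m" if "m \<le> n" for w m n
    by (rule lift_Suc_antimono_le[of "P w", OF P_Suc that])
  have V_n: "V (branch_state left right s0 w n) \<le> q ^ n * V s0" for w n
  proof (induction n)
    case (Suc n)
    have "V (branch_state left right s0 w (Suc n)) \<le> q * V (branch_state left right s0 w n)"
      using contract[OF vn] by simp
    also have "\<dots> \<le> q * (q ^ n * V s0)"
      using Suc q by (intro mult_left_mono) auto
    finally show ?case by simp
  qed simp
  have small: "\<exists>n. \<forall>w. \<forall>x\<in>P w n. \<forall>y\<in>P w n. \<bar>x - y\<bar> < e" if "e > 0" for e
  proof -
    have "(\<lambda>n. q ^ n * V s0) \<longlonglongrightarrow> 0"
      using q by (intro tendsto_mult_left_zero LIMSEQ_power_zero) auto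
    hence "\<forall>\<^sub>F n in sequentially. q ^ n * V s0 < e"
      using that by (rule order_tendstoD)
    then obtain n where n: "q ^ n * V s0 < e"
      by (auto simp: eventually_sequentially)
    have "\<bar>x - y\<bar> < e" if "x \<in> P w n" "y \<in> P w n" for w x y
      using diam[OF vn[of w n], of x y] that V_n[of w n] n by (auto simp: P_def)
    thus ?thesis by blast
  qed
  define pt where "pt w = (SOME x. x \<in> (\<Inter>n. P w n))" for w
  have pt: "pt w \<in> P w n" for w n
  proof -
    have "(\<Inter>n. P w n) \<noteq> {}"
      using vn compact nonempty P_mono by (intro compact_nest) (auto simp: P_def)
    hence "\<exists>x. x \<in> (\<Inter>n. P w n)" by blast
    hence "pt w \<in> (\<Inter>n. P w n)"
      unfolding pt_def by (rule someI_ex)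
    thus ?thesis by blast
  qed
  have P_cong: "P w n = P w' n" if "\<And>m. m < n \<Longrightarrow> w m = w' m" for w w' n
    unfolding P_def using branch_state_cong[of n w w'] that by metis
  have inj: "inj pt"
  proof (rule injI, rule ccontr)
    fix w w' assume eq: "pt w = pt w'" and "w \<noteq> w'"
    hence ex: "\<exists>n. w n \<noteq> w' n" by auto
    define n where "n = (LEAST n. w n \<noteq> w' n)"
    have n: "w n \<noteq> w' n"
      unfolding n_def using ex by (rule LeastI_ex)
    have "w m = w' m" if "m < n" for m
      using not_less_Least[of m "\<lambda>n. w n \<noteq> w' n"] that by (auto simp: n_def)
    hence nd: "branch_state left right s0 w n = branch_state left right s0 w' n"
      by (rule branch_state_cong)
    have "P w (Suc n) \<inter> P w' (Suc n) = {}"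
      using disjoint[OF vn[of w' n]] n nd by (auto simp: P_def)
    thus False
      using pt[of w "Suc n"] pt[of w' "Suc n"] eq by auto
  qed
  have surj: "pt ` UNIV = piece s0"
  proof (intro equalityI subsetI)
    fix x assume "x \<in> pt ` UNIV"
    thus "x \<in> piece s0" using pt[of _ 0] P_0 by auto
  next
    fix x assume x: "x \<in> piece s0"
    define t where "t = rec_nat s0 (\<lambda>_ s. if x \<in> piece (right s) then right s else left s)"
    define w where "w n \<longleftrightarrow> x \<in> piece (right (t n))" for n
    have t: "branch_state left right s0 w n = t n" for n
      by (induction n) (auto simp: t_def w_def)
    have xP: "x \<in> P w n" for n
    proof (induction n)
      case (Suc n)
      thus ?case
        using split[OF vn[of w n]] by (auto simp: P_def t) (auto simp: w_def)
    qed (simp add: P_0 x)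
    have "\<bar>x - pt w\<bar> < e" if "e > 0" for e
      using small[OF that] xP pt by blast
    hence "x = pt w"
      by (metis abs_ge_zero less_irrefl order_le_less zero_less_abs_iff eq_iff_diff_eq_0)
    thus "x \<in> pt ` UNIV" by blast
  qed
  have "continuous_map binary_sequences (top_of_set (piece s0)) pt"
  proof -
    have "continuous_map binary_sequences (mtopology_of euclidean_metric) pt"
      unfolding mtopology_of_def
    proof (subst Metric_space.continuous_map_to_metric[OF Metric_space_mspace_mdist], intro ballI allI impI)
      fix w :: "nat \<Rightarrow> bool" and e :: real assume "e > 0"
      then obtain n where n: "\<And>w x y. x \<in> P w n \<Longrightarrow> y \<in> P w n \<Longrightarrow> \<bar>x - y\<bar> < e"
        using small by blast
      have "pt w' \<in> ball (pt w) e" if "\<forall>m<n. w' m = w m" for w'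
      proof -
        have "pt w' \<in> P w n"
          using pt[of w' n] P_cong[of n w w'] that by auto
        thus ?thesis
          using n[OF pt[of w n]] by (simp add: dist_real_def)
      qed
      thus "\<exists>U. openin binary_sequences U \<and> w \<in> U \<and>
          (\<forall>y\<in>U. pt y \<in> Metric_space.mball (mspace euclidean_metric) (mdist euclidean_metric) (pt w) e)"
        using openin_cylinder[of n w] by (intro exI[of _ "{w'. \<forall>m<n. w' m = w m}"]) auto
    qed
    hence "continuous_map binary_sequences euclideanreal pt"
      by simp
    thus ?thesis
      using surj by (auto simp: continuous_map_in_subtopology)
  qed
  moreover have "compact_space binary_sequences"
    by (auto simp: compact_space_product_topology compact_space_discrete_topology)
  moreover have "Hausdorff_space (top_of_set (piece s0))"
    by (simp add: Hausdorff_space_subtopology Hausdorff_space_euclidean)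
  ultimately have "homeomorphic_map binary_sequences (top_of_set (piece s0)) pt"
    using inj surj by (intro continuous_imp_homeomorphic_map) auto
  thus ?thesis
    using homeomorphic_map_imp_homeomorphic_space by blast
qed

section \<open>The middle-thirds Cantor set\<close>

lemma cantor_stage_subset: "cantor_stage n \<subseteq> {0..1}"
  by (induction n) auto

lemma compact_cantor_set: "compact cantor_set"
proof -
  have "compact (cantor_stage n)" for n
    by (induction n) (auto intro!: compact_Un compact_continuous_image continuous_intros)
  thus ?thesis
    unfolding cantor_set_def by (intro compact_Inter) auto
qed

lemma zero_in_cantor_set: "0 \<in> cantor_set"
proof -
  have "0 \<in> cantor_stage n" for n
    by (induction n) auto
  thus ?thesis by (simp add: cantor_set_def)
qed

lemma cantor_set_bounds: "x \<in> cantor_set \<Longrightarrow> 0 \<le> x" "x \<in> cantor_set \<Longrightarrow> x \<le> 1"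
proof -
  have "cantor_set \<subseteq> cantor_stage 0" unfolding cantor_set_def by blast
  thus "x \<in> cantor_set \<Longrightarrow> 0 \<le> x" "x \<in> cantor_set \<Longrightarrow> x \<le> 1" by auto
qed

lemma cantor_set_self_similar:
  "cantor_set = (\<lambda>x. x / 3) ` cantor_set \<union> (\<lambda>x. (2 + x) / 3) ` cantor_set"
proof (intro equalityI subsetI)
  fix x assume x: "x \<in> cantor_set"
  hence S: "x \<in> (\<lambda>x. x / 3) ` cantor_stage n \<union> (\<lambda>x. (2 + x) / 3) ` cantor_stage n" for n
    unfolding cantor_set_def using cantor_stage.simps(2)[of n] by blast
  show "x \<in> (\<lambda>x. x / 3) ` cantor_set \<union> (\<lambda>x. (2 + x) / 3) ` cantor_set"
  proof (cases "x \<le> 1/2")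
    case True
    have "3 * x \<in> cantor_stage n" for n
      using S[of n] True cantor_stage_subset[of n] by auto
    hence "3 * x \<in> cantor_set" by (simp add: cantor_set_def)
    moreover have "x = (3 * x) / 3" by simp
    ultimately show ?thesis by blast
  next
    case False
    have "3 * x - 2 \<in> cantor_stage n" for n
      using S[of n] False cantor_stage_subset[of n] by (auto simp: add_divide_distrib)
    hence "3 * x - 2 \<in> cantor_set" by (simp add: cantor_set_def)
    moreover have "x = (2 + (3 * x - 2)) / 3" by simp
    ultimately show ?thesis by blast
  qed
next
  fix x assume x: "x \<in> (\<lambda>x. x / 3) ` cantor_set \<union> (\<lambda>x. (2 + x) / 3) ` cantor_set"
  have "x \<in> cantor_stage n" for n
  proof (cases n)
    case 0
    thus ?thesis using x cantor_set_bounds by fastforce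
  next
    case (Suc m)
    thus ?thesis using x by (auto simp: cantor_set_def)
  qed
  thus "x \<in> cantor_set" by (simp add: cantor_set_def)
qed

lemma binary_sequences_homeomorphic_cantor_set:
  "binary_sequences homeomorphic_space top_of_set cantor_set"
proof -
  define piece :: "real \<times> real \<Rightarrow> real set" where "piece = (\<lambda>(u, s). (\<lambda>x. u + s * x) ` cantor_set)"
  define left :: "real \<times> real \<Rightarrow> real \<times> real" where "left = (\<lambda>(u, s). (u, s / 3))"
  define right :: "real \<times> real \<Rightarrow> real \<times> real" where "right = (\<lambda>(u, s). (u + 2 * s / 3, s / 3))"
  have "binary_sequences homeomorphic_space top_of_set (piece (0, 1))"
  proof (rule binary_splitting_homeomorphic[where valid = "\<lambda>(u, s). s > 0" and V = snd and q = "1/3"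
        and left = left and right = right])
    fix z :: "real \<times> real" assume valid: "case z of (u, s) \<Rightarrow> s > 0"
    obtain u s where z: "z = (u, s)" and s: "s > 0" using valid by (cases z) auto
    show "case left z of (u, s) \<Rightarrow> s > 0" "case right z of (u, s) \<Rightarrow> s > 0"
      "snd (left z) \<le> 1/3 * snd z" "snd (right z) \<le> 1/3 * snd z"
      using s by (auto simp: z left_def right_def)
    show "compact (piece z)"
      by (auto simp: z piece_def intro!: compact_continuous_image continuous_intros compact_cantor_set)
    show "piece z \<noteq> {}" using zero_in_cantor_set by (auto simp: z piece_def)
    have "piece z = (\<lambda>x. u + s * x) ` ((\<lambda>x. x / 3) ` cantor_set \<union> (\<lambda>x. (2 + x) / 3) ` cantor_set)"
      using cantor_set_self_similar by (simp add: z piece_def)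
    thus "piece z = piece (left z) \<union> piece (right z)"
      by (simp add: z piece_def left_def right_def image_Un image_image algebra_simps add_divide_distrib)
    show "piece (left z) \<inter> piece (right z) = {}"
    proof -
      have "u + s / 3 * x \<noteq> u + 2 * s / 3 + s / 3 * y" if "x \<in> cantor_set" "y \<in> cantor_set" for x y
      proof -
        have "s / 3 * x \<le> s / 3" "0 \<le> s / 3 * y"
          using s cantor_set_bounds[OF that(1)] cantor_set_bounds[OF that(2)] by (auto simp: mult_le_cancel_left1)
        thus ?thesis using s by linarith
      qed
      thus ?thesis by (auto simp: z piece_def left_def right_def)
    qed
    show "\<bar>x - y\<bar> \<le> snd z" if "x \<in> piece z" "y \<in> piece z" for x y
    proof -
      obtain a b where ab: "a \<in> cantor_set" "x = u + s * a" "b \<in> cantor_set" "y = u + s * b"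
        using \<open>x \<in> piece z\<close> \<open>y \<in> piece z\<close> by (auto simp: z piece_def)
      have "\<bar>x - y\<bar> = s * \<bar>a - b\<bar>"
        using s by (simp add: ab abs_mult flip: right_diff_distrib)
      also have "\<dots> \<le> s * 1"
        using s cantor_set_bounds[OF ab(1)] cantor_set_bounds[OF ab(3)] by (intro mult_left_mono) auto
      finally show ?thesis by (simp add: z)
    qed
  qed auto
  moreover have "piece (0, 1) = cantor_set" by (simp add: piece_def)
  ultimately show ?thesis by simp
qed

section \<open>Expansions without the digit 0\<close>

text \<open>
  The numbers with an expansion \<open>0.k\<^sub>1k\<^sub>2\<dots>\<close> to base \<open>d\<close> all of whose digits are nonzero. Reading off
  the first digit is the map \<open>y \<mapsto> d * y - k\<close>, and a number has such an expansion iff these maps can be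
  iterated forever inside a bounded interval. In the coinductive form membership is shown by
  exhibiting an invariant set, without forming series. The interval \<open>[0, 2]\<close>
  contains the lifts of orbits to which this is applied; the exact bounds follow from
  self-similarity.
\<close>
coinductive_set nonzero_digits :: "nat \<Rightarrow> real set" for d where
  digit: "\<lbrakk>0 \<le> y; y \<le> 2; k \<in> {1..<d}; real d * y - real k \<in> nonzero_digits d\<rbrakk> \<Longrightarrow> y \<in> nonzero_digits d"

lemma nonzero_digits_self_similar:
  assumes "d \<ge> 3"
  shows "nonzero_digits d = (\<Union>k\<in>{1..<d}. (\<lambda>y. (real k + y) / real d) ` nonzero_digits d)"
proof (intro equalityI subsetI)
  fix y assume "y \<in> nonzero_digits d"
  then obtain k where k: "k \<in> {1..<d}" "real d * y - real k \<in> nonzero_digits d"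
    by (cases rule: nonzero_digits.cases) auto
  moreover have "y = (real k + (real d * y - real k)) / real d"
    using assms by simp
  ultimately show "y \<in> (\<Union>k\<in>{1..<d}. (\<lambda>y. (real k + y) / real d) ` nonzero_digits d)"
    by blast
next
  fix y assume "y \<in> (\<Union>k\<in>{1..<d}. (\<lambda>y. (real k + y) / real d) ` nonzero_digits d)"
  then obtain k z where k: "k \<in> {1..<d}" and z: "z \<in> nonzero_digits d" and y: "y = (real k + z) / real d"
    by blast
  have "0 \<le> z" "z \<le> 2"
    using z by (auto elim: nonzero_digits.cases)
  moreover have "real k + z \<le> 2 * real d"
    using \<open>z \<le> 2\<close> k assms by auto
  ultimately show "y \<in> nonzero_digits d"
    using k z assms by (intro digit[of y k d]) (auto simp: y field_simps)
qed

lemma one_in_nonzero_digits: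
  assumes "d \<ge> 3"
  shows "1 \<in> nonzero_digits d"
proof -
  have "x \<in> {1} \<Longrightarrow> x \<in> nonzero_digits d" for x
    by (coinduction arbitrary: x rule: nonzero_digits.coinduct)
       (use assms in \<open>auto intro!: exI[of _ "d - 1"] simp: of_nat_diff\<close>)
  thus ?thesis by simp
qed

text \<open>
  Both extremal values belong to constant digit sequences. Self-similarity gives
  \<open>(1 + Inf) / d \<le> Inf\<close> and \<open>Sup \<le> (d - 1 + Sup) / d\<close>, which determines the bounds.
\<close>
lemma nonzero_digits_bounds:
  assumes "d \<ge> 3" "y \<in> nonzero_digits d"
  shows "1 / (real d - 1) \<le> y" "y \<le> 1"
proof -
  let ?D = "nonzero_digits d"
  have D2: "0 \<le> y \<and> y \<le> 2" if "y \<in> ?D" for y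
    using that by (auto elim: nonzero_digits.cases)
  have bdd: "bdd_below ?D" "bdd_above ?D"
    using D2 by (intro bdd_belowI[of _ 0] bdd_aboveI[of _ 2]; blast)+
  have ne: "?D \<noteq> {}" using assms by auto
  have low: "(1 + Inf ?D) / real d \<le> y" and high: "y \<le> (real d - 1 + Sup ?D) / real d"
    if "y \<in> ?D" for y
  proof -
    obtain k z where kz: "k \<in> {1..<d}" "z \<in> ?D" "y = (real k + z) / real d"
      using \<open>y \<in> ?D\<close> nonzero_digits_self_similar[OF assms(1)] by blast
    have "Inf ?D \<le> z" "z \<le> Sup ?D"
      using kz bdd by (auto intro: cInf_lower cSup_upper)
    moreover have "1 \<le> real k" "real k \<le> real d - 1"
      using kz(1) by auto
    ultimately show "(1 + Inf ?D) / real d \<le> y" "y \<le> (real d - 1 + Sup ?D) / real d"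
      unfolding kz(3) by (auto intro!: divide_right_mono)
  qed
  have "(1 + Inf ?D) / real d \<le> Inf ?D" "Sup ?D \<le> (real d - 1 + Sup ?D) / real d"
    using ne low high by (auto intro: cInf_greatest cSup_least)
  hence "1 \<le> (real d - 1) * Inf ?D" "(real d - 1) * Sup ?D \<le> (real d - 1) * 1"
    using assms(1) by (auto simp: field_simps)
  moreover have "0 < real d - 1" using assms(1) by simp
  ultimately have "1 / (real d - 1) \<le> Inf ?D" "Sup ?D \<le> 1"
    by (simp add: divide_le_eq mult.commute) (metis \<open>0 < real d - 1\<close> \<open>(real d - 1) * Sup ?D \<le> (real d - 1) * 1\<close> mult_le_cancel_left_pos)
  moreover have "Inf ?D \<le> y" "y \<le> Sup ?D"
    using assms(2) bdd by (auto intro: cInf_lower cSup_upper)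
  ultimately show "1 / (real d - 1) \<le> y" "y \<le> 1" by linarith+
qed

text \<open>
  The closure satisfies the same inclusion in the union of its \<open>d - 1\<close> shrunk copies, because this
  union is closed; so coinduction applies to it.
\<close>
lemma compact_nonzero_digits:
  assumes "d \<ge> 3"
  shows "compact (nonzero_digits d)"
proof -
  let ?D = "nonzero_digits d"
  let ?U = "\<Union>k\<in>{1..<d}. (\<lambda>y. (real k + y) / real d) ` closure ?D"
  have D2: "?D \<subseteq> {0..2}"
    by (auto elim: nonzero_digits.cases)
  hence cl2: "closure ?D \<subseteq> {0..2}"
    by (intro closure_minimal) auto
  have "bounded ?D"
    using D2 bounded_subset bounded_closed_interval by blast
  hence cpt: "compact (closure ?D)" by simp
  have "compact ?U"
    using assms by (intro compact_UN compact_continuous_image cpt continuous_intros) auto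
  moreover have "?D \<subseteq> ?U"
    by (subst nonzero_digits_self_similar[OF assms]) (use closure_subset in blast)
  ultimately have U: "closure ?D \<subseteq> ?U"
    by (intro closure_minimal compact_imp_closed)
  have "closure ?D \<subseteq> ?D"
  proof
    fix y show "y \<in> closure ?D \<Longrightarrow> y \<in> ?D"
    proof (coinduction arbitrary: y rule: nonzero_digits.coinduct)
      case (nonzero_digits y)
      then obtain k z where k: "k \<in> {1..<d}" and z: "z \<in> closure ?D" "y = (real k + z) / real d"
        using U by blast
      hence "z = real d * y - real k" using assms by simp
      thus ?case using k z(1) nonzero_digits cl2 by (intro exI[of _ y] exI[of _ k]) auto
    qed
  qed
  thus ?thesis
    using cpt closure_subset by (metis subset_antisym)
qed

text \<open>
  Keep the first \<open>n\<close> digits and replace the tail by \<open>d - 1, d - 1, \<dots>\<close>, which represents 1.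
\<close>
lemma nonzero_digits_rational_approx_power:
  assumes "d \<ge> 3" "y \<in> nonzero_digits d"
  shows "\<exists>y'\<in>nonzero_digits d \<inter> \<rat>. \<bar>y - y'\<bar> \<le> (1 / real d) ^ n"
  using assms(2)
proof (induction n arbitrary: y)
  case 0
  have "0 \<le> 1 / (real d - 1)" using assms(1) by simp
  hence "\<bar>y - 1\<bar> \<le> (1 / real d) ^ 0"
    using nonzero_digits_bounds[OF assms(1) 0] unfolding power_0 by linarith
  thus ?case
    using one_in_nonzero_digits[OF assms(1)] by (intro bexI[of _ 1]) auto
next
  case (Suc n)
  obtain k z where kz: "k \<in> {1..<d}" "z \<in> nonzero_digits d" "y = (real k + z) / real d"
    using Suc.prems nonzero_digits_self_similar[OF assms(1)] by blast
  obtain z' where z': "z' \<in> nonzero_digits d" "z' \<in> \<rat>" "\<bar>z - z'\<bar> \<le> (1 / real d) ^ n"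
    using Suc.IH[OF kz(2)] by blast
  have "\<bar>y - (real k + z') / real d\<bar> = \<bar>z - z'\<bar> / real d"
    using assms(1) by (simp add: kz(3) abs_divide flip: diff_divide_distrib)
  also have "\<dots> \<le> (1 / real d) ^ n / real d"
    using z' by (intro divide_right_mono) auto
  finally have "\<bar>y - (real k + z') / real d\<bar> \<le> (1 / real d) ^ Suc n"
    by simp
  moreover have "(real k + z') / real d \<in> nonzero_digits d"
    using kz(1) z'(1) nonzero_digits_self_similar[OF assms(1)] by blast
  ultimately show ?case
    using z'(2) by (intro bexI[of _ "(real k + z') / real d"]) auto
qed

lemma nonzero_digits_rational_dense:
  assumes "d \<ge> 3" "y \<in> nonzero_digits d" "e > 0"
  shows "\<exists>y'\<in>nonzero_digits d \<inter> \<rat>. \<bar>y - y'\<bar> < e"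
proof -
  have "1 / real d < 1" using assms(1) by simp
  then obtain n where "(1 / real d) ^ n < e"
    using real_arch_pow_inv[OF assms(3)] by blast
  thus ?thesis
    using nonzero_digits_rational_approx_power[OF assms(1,2), of n] by force
qed

text \<open>
  The summand \<open>y / d\<close> prepends the digit 0; the summand \<open>j / (d - 1)\<close> accounts for the rotational
  symmetry of multiplication by \<open>d\<close>.
\<close>
definition maximizing_angles :: "nat \<Rightarrow> real set" where
  "maximizing_angles d =
    (\<Union>j\<in>{..<d - 1}. (\<lambda>y. real j / (real d - 1) + y / real d) ` nonzero_digits d)"

lemma compact_maximizing_angles:
  assumes "d \<ge> 3"
  shows "compact (maximizing_angles d)"
  unfolding maximizing_angles_def using assms
  by (intro compact_UN compact_continuous_image compact_nonzero_digits continuous_intros) auto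

lemma maximizing_angles_rational_dense:
  assumes "d \<ge> 3" "t \<in> maximizing_angles d" "e > 0"
  shows "\<exists>t'\<in>maximizing_angles d \<inter> \<rat>. \<bar>t' - t\<bar> < e"
proof -
  obtain j y where jy: "j < d - 1" "y \<in> nonzero_digits d" "t = real j / (real d - 1) + y / real d"
    using assms(2) by (auto simp: maximizing_angles_def)
  obtain y' where y': "y' \<in> nonzero_digits d" "y' \<in> \<rat>" "\<bar>y - y'\<bar> < e"
    using nonzero_digits_rational_dense[OF assms(1) jy(2) assms(3)] by blast
  let ?t = "real j / (real d - 1) + y' / real d"
  have "?t - t = (y' - y) / real d"
    by (simp add: jy(3) diff_divide_distrib)
  hence "\<bar>?t - t\<bar> = \<bar>y - y'\<bar> / real d"
    by (simp add: abs_divide abs_minus_commute)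
  also have "\<dots> \<le> \<bar>y - y'\<bar>" using assms(1) by (simp add: divide_le_eq mult_le_cancel_left1)
  finally have "\<bar>?t - t\<bar> < e" using y'(3) by simp
  moreover have "?t \<in> maximizing_angles d"
    using jy(1) y'(1) unfolding maximizing_angles_def by blast
  moreover have "?t \<in> \<rat>" using y'(2) by simp
  ultimately show ?thesis by blast
qed

lemma affine_nonzero_digits_split:
  assumes "d \<ge> 3"
  shows "(\<lambda>y. v + s * y) ` nonzero_digits d
    = (\<Union>k\<in>{1..<d}. (\<lambda>y. v + s / real d * real k + s / real d * y) ` nonzero_digits d)"
  using assms
  by (subst nonzero_digits_self_similar[OF assms])
     (simp add: image_UN image_image distrib_left add_divide_distrib add.assoc)

text \<open>
  A state \<open>(u, t, s, i)\<close> stands for the copies of the digit set, scaled by \<open>s\<close> and placed at the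
  positions \<open>u + t * k\<close> with \<open>i \<le> k < d\<close>. It is split into the first copy and the remaining ones. A single
  copy is turned back into a state by its own self-similarity, with both spacing and scale
  divided by \<open>d\<close>. Every valid state has at least two copies, which is where \<open>d \<ge> 3\<close> enters.
\<close>
lemma binary_sequences_homeomorphic_maximizing_angles:
  assumes d: "d \<ge> 3"
  shows "binary_sequences homeomorphic_space top_of_set (maximizing_angles d)"
proof -
  define piece :: "real \<times> real \<times> real \<times> nat \<Rightarrow> real set" where
    "piece = (\<lambda>(u, t, s, i). \<Union>k\<in>{i..<d}. (\<lambda>y. u + t * real k + s * y) ` nonzero_digits d)"
  define left :: "real \<times> real \<times> real \<times> nat \<Rightarrow> real \<times> real \<times> real \<times> nat" where
    "left = (\<lambda>(u, t, s, i). (u + t * real i, s / real d, s / real d, 1))"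
  define right :: "real \<times> real \<times> real \<times> nat \<Rightarrow> real \<times> real \<times> real \<times> nat" where
    "right = (\<lambda>(u, t, s, i). if i = d - 2 then (u + t * (real d - 1), s / real d, s / real d, 1)
                             else (u, t, s, Suc i))"
  define valid :: "real \<times> real \<times> real \<times> nat \<Rightarrow> bool" where
    "valid = (\<lambda>(u, t, s, i). 0 < s \<and> s \<le> t \<and> 1 \<le> i \<and> i \<le> d - 2)"
  define V :: "real \<times> real \<times> real \<times> nat \<Rightarrow> real" where
    "V = (\<lambda>(u, t, s, i). t * (real d - real i))"
  define q where "q = (real d - 2) / (real d - 1)"
  note bounds = nonzero_digits_bounds[OF d]
  have b_pos: "0 < 1 / (real d - 1)" using d by simp
  have pos: "0 < y" if "y \<in> nonzero_digits d" for y
    using bounds[OF that] b_pos by linarith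
  have piece_left: "piece (left (u, t, s, i)) = (\<lambda>y. u + t * real i + s * y) ` nonzero_digits d" for u t s i
    by (simp add: piece_def left_def affine_nonzero_digits_split[OF d, of "u + t * real i" s])
  have piece_right: "piece (right (u, t, s, i)) = (\<Union>k\<in>{Suc i..<d}. (\<lambda>y. u + t * real k + s * y) ` nonzero_digits d)"
    if "1 \<le> i" "i \<le> d - 2" for u t s i
  proof (cases "i = d - 2")
    case True
    have "{Suc i..<d} = {d - 1}" using True d by auto
    thus ?thesis
      using True d affine_nonzero_digits_split[OF d, of "u + t * (real d - 1)" s]
      by (simp add: piece_def right_def of_nat_diff)
  next
    case False
    thus ?thesis by (simp add: piece_def right_def)
  qed
  have "binary_sequences homeomorphic_space
      top_of_set (piece (- (1 / (real d - 1)), 1 / (real d - 1), 1 / real d, 1))"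
  proof (rule binary_splitting_homeomorphic[where valid = valid and V = V and q = q
        and left = left and right = right])
    fix z :: "real \<times> real \<times> real \<times> nat" assume "valid z"
    then obtain u t s i where z: "z = (u, t, s, i)" and s: "0 < s" "s \<le> t" and i: "1 \<le> i" "i \<le> d - 2"
      by (cases z) (auto simp: valid_def)
    have i2: "real i \<le> real d - 2" using i d by linarith
    show "valid (left z)" "valid (right z)"
      using s i d by (auto simp: z valid_def left_def right_def)
    show "compact (piece z)"
      unfolding z piece_def prod.case
      by (intro compact_UN compact_continuous_image compact_nonzero_digits[OF d] continuous_intros) auto
    have "i \<in> {i..<d}" using i d by auto
    thus "piece z \<noteq> {}"
      using one_in_nonzero_digits[OF d] by (auto simp: z piece_def)
    have "{i..<d} = insert i {Suc i..<d}"
      using i d by auto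
    thus "piece z = piece (left z) \<union> piece (right z)"
      unfolding z piece_left piece_right[OF i] by (simp add: piece_def)
    \<comment> \<open>Digit sets lie in \<open>(0, 1]\<close> and \<open>s \<le> t\<close>, so neighbouring copies do not overlap.\<close>
    show "piece (left z) \<inter> piece (right z) = {}"
    proof -
      have "u + t * real i + s * x \<noteq> u + t * real k + s * y"
        if xy: "x \<in> nonzero_digits d" "y \<in> nonzero_digits d" and k: "Suc i \<le> k" for x y k
      proof -
        have "s * x \<le> s * 1" "0 < s * y"
          using s bounds[OF xy(1)] pos[OF xy(2)] by (auto simp del: mult_1_right intro!: mult_left_mono)
        moreover have "t * (real i + 1) \<le> t * real k"
          using s k by (intro mult_left_mono) auto
        ultimately show ?thesis using s unfolding distrib_left by linarith
      qed
      thus ?thesis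
        unfolding z piece_left piece_right[OF i] by fastforce
    qed
    show "\<bar>x - y\<bar> \<le> V z" if xy: "x \<in> piece z" "y \<in> piece z" for x y
    proof -
      have rng: "u + t * real i \<le> x \<and> x \<le> u + t * (real d - 1) + s" if "x \<in> piece z" for x
      proof -
        obtain k y where k: "k \<in> {i..<d}" "y \<in> nonzero_digits d" "x = u + t * real k + s * y"
          using \<open>x \<in> piece z\<close> by (auto simp: z piece_def)
        have "t * real i \<le> t * real k" "t * real k \<le> t * (real d - 1)"
          using s k(1) by (auto intro!: mult_left_mono)
        moreover have "s * y \<le> s * 1" "0 < s * y"
          using s bounds[OF k(2)] pos[OF k(2)] by (auto simp del: mult_1_right intro!: mult_left_mono)
        ultimately show ?thesis using k(3) by auto
      qed
      have "V z = t * (real d - 1) + t - t * real i"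
        by (simp add: V_def z algebra_simps)
      thus ?thesis using rng[OF xy(1)] rng[OF xy(2)] s by linarith
    qed
    \<comment> \<open>The estimate for passing to a single copy; it uses that \<open>d - i \<ge> 2\<close>.\<close>
    have key: "s / real d * (real d - 1) \<le> q * (t * (real d - real i))"
    proof -
      have "s / real d * (real d - 1) \<le> t * ((real d - 1) / real d)"
        using s d by (simp add: divide_right_mono mult_right_mono)
      also have "(real d - 1) / real d \<le> q * 2"
      proof -
        have "3 * real d \<le> real d * real d"
          using d by (intro mult_right_mono) auto
        moreover have "3 \<le> real d" using d by simp
        ultimately have "1 + real d * 2 \<le> real d * real d" by linarith
        hence "(real d - 1) * (real d - 1) \<le> 2 * (real d - 2) * real d"
          by (simp add: algebra_simps)
        thus ?thesis using d by (simp add: q_def field_simps)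
      qed
      also have "q * 2 \<le> q * (real d - real i)"
        using d i2 by (intro mult_left_mono) (auto simp: q_def)
      finally show ?thesis using s by (simp add: mult_ac)
    qed
    show "V (left z) \<le> q * V z"
      using key by (simp add: V_def z left_def)
    show "V (right z) \<le> q * V z"
    proof (cases "i = d - 2")
      case True
      thus ?thesis using key by (simp add: V_def z right_def)
    next
      case False
      have "real d - real i - 1 \<le> q * (real d - real i)"
        using d i by (simp add: q_def field_simps)
      hence "t * (real d - real i - 1) \<le> t * (q * (real d - real i))"
        using s by (intro mult_left_mono) auto
      thus ?thesis using False by (simp add: V_def z right_def algebra_simps)
    qed
  next
    show "valid (- (1 / (real d - 1)), 1 / (real d - 1), 1 / real d, 1)"
      using d by (auto simp: valid_def field_simps)
    show "0 \<le> q" "q < 1" using d by (auto simp: q_def)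
  qed
  moreover have "piece (- (1 / (real d - 1)), 1 / (real d - 1), 1 / real d, 1) = maximizing_angles d"
  proof -
    have "{1..<d} = Suc ` {..<d - 1}"
      using d by (simp add: image_Suc_lessThan atLeastLessThanSuc_atLeastAtMost[symmetric])
    thus ?thesis
      by (simp add: piece_def maximizing_angles_def add_divide_distrib)
  qed
  ultimately show ?thesis by simp
qed

section \<open>Unicritical majors\<close>

definition critical_leaf :: "nat \<Rightarrow> real \<Rightarrow> real set" where
  "critical_leaf d t = {x \<in> circle. circle_map d x = t}"

lemma frac_in_circle [simp]: "frac z \<in> circle"
  by (simp add: circle_def frac_lt_1)

lemma frac_circle: "x \<in> circle \<Longrightarrow> frac x = x"
  by (simp add: circle_def frac_eq)

lemma circle_map_in_circle [simp]: "circle_map d x \<in> circle"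
  by (simp add: circle_map_def)

lemma frac_eq_frac_iff: "frac a = frac b \<longleftrightarrow> a - b \<in> \<int>" for a b :: real
proof -
  have "a - frac b \<in> \<int> \<longleftrightarrow> a - b \<in> \<int>"
    using Ints_diff[of "a - frac b" "of_int \<lfloor>b\<rfloor>"] Ints_add[of "a - b" "of_int \<lfloor>b\<rfloor>"]
    by (auto simp: frac_def algebra_simps)
  thus ?thesis
    by (simp add: frac_unique_iff frac_lt_1)
qed

lemma circle_map_frac: "circle_map d (frac z) = frac (real d * z)"
proof -
  have "real d * frac z - real d * z = of_int (- (int d * \<lfloor>z\<rfloor>))"
    by (simp add: frac_def algebra_simps)
  hence "real d * frac z - real d * z \<in> \<int>"
    by (metis Ints_of_int)
  thus ?thesis by (simp add: circle_map_def frac_eq_frac_iff)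
qed

lemma frac_in_critical_leaf_iff:
  assumes "t \<in> circle"
  shows "frac z \<in> critical_leaf d t \<longleftrightarrow> real d * z - t \<in> \<int>"
proof -
  have "circle_map d (frac z) = t \<longleftrightarrow> frac (real d * z) = frac t"
    by (simp add: circle_map_frac frac_circle[OF assms])
  thus ?thesis by (simp add: critical_leaf_def frac_eq_frac_iff)
qed

lemma critical_leaf_eq:
  assumes "d > 0" "t \<in> circle"
  shows "critical_leaf d t = (\<lambda>k. (t + real k) / real d) ` {..<d}"
proof (intro equalityI subsetI)
  fix x assume x: "x \<in> critical_leaf d t"
  hence xc: "x \<in> circle" by (simp add: critical_leaf_def)
  have "real d * x - t \<in> \<int>"
    using x frac_in_critical_leaf_iff[OF assms(2), of x d] frac_circle[OF xc] by simp
  then obtain k where k: "real d * x - t = of_int k" by (auto elim: Ints_cases)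
  have "0 \<le> real d * x" "real d * x < real d * 1"
    using xc assms(1) unfolding circle_def by (auto simp del: mult_1_right intro!: mult_strict_left_mono)
  hence "-1 < real_of_int k" "real_of_int k < real d"
    using k assms(2) by (auto simp: circle_def)
  hence "0 \<le> k" "k < int d" by linarith+
  moreover have "x = (t + real (nat k)) / real d"
    using k assms(1) \<open>0 \<le> k\<close> by (simp add: field_simps)
  ultimately show "x \<in> (\<lambda>k. (t + real k) / real d) ` {..<d}"
    by (intro image_eqI[of _ _ "nat k"]) auto
next
  fix x assume "x \<in> (\<lambda>k. (t + real k) / real d) ` {..<d}"
  then obtain k where k: "k < d" "x = (t + real k) / real d" by auto
  have "t + real k < real d"
    using k(1) assms(2) by (auto simp: circle_def)
  hence xc: "x \<in> circle"
    using assms k by (auto simp: circle_def)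
  have "real d * x - t = of_int (int k)"
    using k assms(1) by simp
  hence "real d * x - t \<in> \<int>" by (metis Ints_of_int)
  thus "x \<in> critical_leaf d t"
    using frac_in_critical_leaf_iff[OF assms(2), of x d] frac_circle[OF xc] by simp
qed

lemma finite_critical_leaf: "d > 0 \<Longrightarrow> t \<in> circle \<Longrightarrow> finite (critical_leaf d t)"
  by (simp add: critical_leaf_eq)

lemma card_critical_leaf:
  assumes "d > 0" "t \<in> circle"
  shows "card (critical_leaf d t) = d"
proof -
  have "inj_on (\<lambda>k. (t + real k) / real d) {..<d}"
    using assms(1) by (auto simp: inj_on_def)
  thus ?thesis by (simp add: critical_leaf_eq[OF assms] card_image)
qed

lemma leaf_image_critical_leaf:
  assumes "d > 0" "t \<in> circle"
  shows "leaf_image d (critical_leaf d t) = t"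
proof -
  have "critical_leaf d t \<noteq> {}"
    using card_critical_leaf[OF assms] assms(1) by auto
  hence "circle_map d ` critical_leaf d t = {t}"
    by (auto simp: critical_leaf_def)
  thus ?thesis by (simp add: leaf_image_def)
qed

lemma critical_leaf_primitive_major:
  assumes "d \<ge> 2" "t \<in> circle"
  shows "{critical_leaf d t} \<in> primitive_majors d"
  using assms card_critical_leaf[of d t] finite_critical_leaf[of d t]
  by (auto simp: primitive_majors_def critical_leaf_def)

lemma unicritical_majors_eq:
  assumes "d \<ge> 2"
  shows "unicritical_majors d = (\<lambda>t. {critical_leaf d t}) ` circle"
proof (intro equalityI subsetI)
  fix M assume "M \<in> unicritical_majors d"
  then obtain L where M: "M \<in> primitive_majors d" "M = {L}" "card L = d"
    by (auto simp: unicritical_majors_def)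
  have "\<forall>K\<in>M. \<forall>x\<in>K. \<forall>y\<in>K. circle_map d x = circle_map d y"
    using M(1) unfolding primitive_majors_def mem_Collect_eq by (elim conjE)
  hence same: "circle_map d x = circle_map d y" if "x \<in> L" "y \<in> L" for x y
    using that M(2) by blast
  have L: "L \<subseteq> circle"
    using primitive_majors_leaf(1)[OF M(1)] M(2) by blast
  obtain x where x: "x \<in> L" using M(3) assms by fastforce
  define t where "t = circle_map d x"
  have t: "t \<in> circle" by (simp add: t_def)
  have "L \<subseteq> critical_leaf d t"
    using L same[OF _ x] by (auto simp only: t_def critical_leaf_def)
  hence "L = critical_leaf d t"
    using card_critical_leaf[of d t] finite_critical_leaf[of d t] t M(3) assms
    by (intro card_subset_eq) auto
  thus "M \<in> (\<lambda>t. {critical_leaf d t}) ` circle"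
    using M(2) t by blast
next
  fix M assume "M \<in> (\<lambda>t. {critical_leaf d t}) ` circle"
  then obtain t where t: "t \<in> circle" "M = {critical_leaf d t}" by blast
  have "M \<in> primitive_majors d"
    using critical_leaf_primitive_major[OF assms t(1)] t(2) by simp
  thus "M \<in> unicritical_majors d"
    using t card_critical_leaf[of d t] assms by (auto simp: unicritical_majors_def)
qed

lemma critical_leaf_rational:
  assumes "d > 0" "t \<in> circle" "t \<in> \<rat>"
  shows "critical_leaf d t \<subseteq> \<rat>"
  using assms(3) by (auto simp: critical_leaf_eq[OF assms(1,2)])

section \<open>Separation by the critical leaf\<close>

lemma circle_point_frac [simp]: "circle_point (frac z) = circle_point z"
proof -
  have "circle_point z = cis (2 * pi * frac z + 2 * pi * of_int \<lfloor>z\<rfloor>)"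
    by (simp add: circle_point_def frac_def algebra_simps)
  also have "\<dots> = circle_point (frac z)"
    by (simp add: circle_point_def cis_mult[symmetric] cis_multiple_2pi)
  finally show ?thesis by simp
qed

lemma circle_point_eq_iff: "circle_point x = circle_point y \<longleftrightarrow> frac x = frac y"
proof
  assume eq: "circle_point x = circle_point y"
  have "cis (2 * pi * (x - y)) = circle_point x / circle_point y"
    by (simp add: circle_point_def cis_divide algebra_simps)
  also have "\<dots> = 1"
    using eq by (simp add: circle_point_def)
  finally have "cos (2 * pi * (x - y)) = 1"
    by (metis cis.simps(1) one_complex.simps(1))
  then obtain n :: int where "2 * pi * (x - y) = of_int n * 2 * pi"
    using cos_one_2pi_int by blast
  hence "x - y = of_int n" by simp
  thus "frac x = frac y" by (simp add: frac_eq_frac_iff)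
qed (metis circle_point_frac)

lemma circle_point_in_image_iff:
  assumes "L \<subseteq> circle"
  shows "circle_point z \<in> circle_point ` L \<longleftrightarrow> frac z \<in> L"
proof
  assume "circle_point z \<in> circle_point ` L"
  then obtain w where w: "w \<in> L" "circle_point z = circle_point w" by blast
  hence "frac z = frac w" by (simp add: circle_point_eq_iff)
  thus "frac z \<in> L" using w(1) assms frac_circle by (metis subsetD)
qed (metis circle_point_frac imageI)

lemma continuous_on_circle_point: "continuous_on S circle_point"
  unfolding circle_point_def by (intro continuous_intros)

lemma separates_frac [simp]: "separates L (frac x) y = separates L x y" "separates L x (frac y) = separates L x y"
  by (simp_all add: separates_def)

lemma separates_commute: "separates L x y = separates L y x"
  by (auto simp: separates_def Let_def connected_component_sym)

lemma separates_endpoint: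
  assumes "L \<subseteq> circle" "frac x \<in> L \<or> frac y \<in> L"
  shows "\<not> separates L x y"
  using assms circle_point_in_image_iff[OF assms(1)] by (auto simp: separates_def Let_def)

lemma not_separates_refl: "\<not> separates L x x"
  by (auto simp: separates_def Let_def connected_component_refl_eq)

lemma sin_double_sum: "sin (2 * a) + sin (2 * b) - sin (2 * (a + b)) = 4 * sin a * sin b * sin (a + b)" for a b :: real
proof -
  have *: "sin (2 * (a + b)) = 2 * sin (a + b) * cos (a + b)"
    by (simp only: sin_double)
  have id: "2 * s * c + 2 * u * v - 2 * (s * v + c * u) * (c * v - s * u) - 4 * s * u * (s * v + c * u)
      = 2 * s * c * (1 - (u\<^sup>2 + v\<^sup>2)) + 2 * u * v * (1 - (s\<^sup>2 + c\<^sup>2))" for s c u v :: real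
    by (simp add: power2_eq_square algebra_simps)
  have "sin (2 * a) + sin (2 * b) - sin (2 * (a + b)) - 4 * sin a * sin b * sin (a + b) = 0"
    unfolding * sin_double[of a] sin_double[of b] sin_add cos_add
    by (subst id) simp
  thus ?thesis by simp
qed

text \<open>
  The sign of this affine functional tells the two sides of the chord from \<open>p\<close> to \<open>q\<close> apart. On the
  circle it factors into three sines and vanishes only at the two endpoints.
\<close>
definition chord_side :: "real \<Rightarrow> real \<Rightarrow> complex \<Rightarrow> real" where
  "chord_side p q z = Im ((z - circle_point p) * cnj (circle_point q - circle_point p))"

lemma chord_side_circle_point:
  "chord_side p q (circle_point x) = 4 * sin (pi * (x - q)) * sin (pi * (q - p)) * sin (pi * (x - p))"
proof -
  have "chord_side p q (circle_point x)
      = sin (2 * (pi * (x - q))) + sin (2 * (pi * (q - p))) - sin (2 * (pi * (x - q) + pi * (q - p)))"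
    by (simp add: chord_side_def circle_point_def sin_diff cos_diff algebra_simps)
  also have "\<dots> = 4 * sin (pi * (x - q)) * sin (pi * (q - p)) * sin (pi * (x - q) + pi * (q - p))"
    by (rule sin_double_sum)
  also have "pi * (x - q) + pi * (q - p) = pi * (x - p)" by (simp add: algebra_simps)
  finally show ?thesis .
qed

lemma sin_pi_pos: "0 < u \<Longrightarrow> u < 1 \<Longrightarrow> 0 < sin (pi * u)"
  using sin_gt_zero[of "pi * u"] by simp

lemma sin_pi_neg: "-1 < u \<Longrightarrow> u < 0 \<Longrightarrow> sin (pi * u) < 0"
  using sin_pi_pos[of "- u"] by simp

lemma chord_side_neg:
  assumes "p < x" "x < q" "q < p + 1"
  shows "chord_side p q (circle_point x) < 0"
  unfolding chord_side_circle_point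
  using sin_pi_neg[of "x - q"] sin_pi_pos[of "q - p"] sin_pi_pos[of "x - p"] assms
  by (simp add: mult_neg_pos)

lemma chord_side_pos:
  assumes "p < q" "q < x" "x < p + 1"
  shows "0 < chord_side p q (circle_point x)"
  unfolding chord_side_circle_point
  using sin_pi_pos[of "x - q"] sin_pi_pos[of "q - p"] sin_pi_pos[of "x - p"] assms
  by simp

text \<open>
  The arguments are lifts to the real line, so that cyclic order becomes linear order within one
  period. A connected subset of the circle that joins the two sides of the chord contains a zero
  of \<open>chord_side\<close>, that is, an endpoint of the leaf.
\<close>
lemma separates_between:
  assumes L: "L \<subseteq> circle" "frac p \<in> L" "frac q \<in> L" "frac x \<notin> L" "frac y \<notin> L"
    and order: "p < x" "x < q" "q < y" "y < p + 1"
  shows "separates L x y"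
proof -
  let ?C = "sphere 0 1 - circle_point ` L"
  have mem: "circle_point z \<in> ?C \<longleftrightarrow> frac z \<notin> L" for z
    using circle_point_in_image_iff[OF L(1)] by (auto simp: circle_point_def)
  have "\<not> connected_component ?C (circle_point x) (circle_point y)"
  proof
    assume "connected_component ?C (circle_point x) (circle_point y)"
    then obtain K where K: "connected K" "K \<subseteq> ?C" "circle_point x \<in> K" "circle_point y \<in> K"
      unfolding connected_component_def by blast
    have "continuous_on K (chord_side p q)"
      unfolding chord_side_def by (intro continuous_intros)
    hence "connected (chord_side p q ` K)"
      using K(1) by (rule connected_continuous_image)
    moreover have "chord_side p q (circle_point x) \<le> 0" "0 \<le> chord_side p q (circle_point y)"
      using chord_side_neg[of p x q] chord_side_pos[of p q y] order by auto
    ultimately have "0 \<in> chord_side p q ` K"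
      using K(3,4) by (meson connectedD_interval imageI)
    then obtain z where z: "z \<in> K" "chord_side p q z = 0" by auto
    have "norm z = 1" using z K(2) by auto
    hence "z = cis (Arg z)"
      using rcis_cmod_Arg[of z] by (simp add: rcis_def)
    then obtain a where "z = cis a" ..
    hence "z = circle_point (a / (2 * pi))" by (simp add: circle_point_def)
    define w where "w = p + frac (a / (2 * pi) - p)"
    have "z = circle_point w"
    proof -
      have "w - a / (2 * pi) \<in> \<int>"
        by (simp add: w_def frac_def)
      thus ?thesis
        using \<open>z = circle_point (a / (2 * pi))\<close> by (simp add: circle_point_eq_iff frac_eq_frac_iff)
          (metis Ints_minus minus_diff_eq)
    qed
    have w: "p \<le> w" "w < p + 1" by (auto simp: w_def frac_lt_1)
    have "frac w \<notin> L" using mem[of w] K(2) z(1) \<open>z = circle_point w\<close> by blast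
    hence "w \<noteq> p" "w \<noteq> q" using L by auto
    thus False
      using w order z(2) chord_side_neg[of p w q] chord_side_pos[of p q w] \<open>z = circle_point w\<close>
      by fastforce
  qed
  thus ?thesis
    using mem[of x] mem[of y] L by (simp add: separates_def)
qed

text \<open>
  Endpoints of the leaf are the points where \<open>d * x - t\<close> is an integer, so the integer part of
  \<open>d * x - t\<close> numbers the sectors modulo \<open>d\<close>.
\<close>
lemma not_separates_same_floor:
  assumes t: "t \<in> circle" and fl: "\<lfloor>real d * x - t\<rfloor> = \<lfloor>real d * y - t\<rfloor>"
  shows "\<not> separates (critical_leaf d t) x y"
proof (cases "frac x \<in> critical_leaf d t \<or> frac y \<in> critical_leaf d t")
  case True
  have "critical_leaf d t \<subseteq> circle" by (auto simp: critical_leaf_def)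
  thus ?thesis using True by (rule separates_endpoint)
next
  case False
  let ?L = "critical_leaf d t"
  let ?n = "\<lfloor>real d * x - t\<rfloor>"
  have L: "?L \<subseteq> circle" by (auto simp: critical_leaf_def)
  have strict: "of_int ?n < real d * u - t" "real d * u - t < of_int ?n + 1" if "u \<in> {x, y}" for u
  proof -
    have "real d * u - t \<notin> \<int>"
      using False that frac_in_critical_leaf_iff[OF t, of u d] by auto
    hence "real d * u - t \<noteq> of_int ?n" by (metis Ints_of_int)
    moreover have "\<lfloor>real d * u - t\<rfloor> = ?n" using fl that by auto
    ultimately show "of_int ?n < real d * u - t" "real d * u - t < of_int ?n + 1"
      by linarith+
  qed
  have conv: "convex {u. of_int ?n < real d * u - t \<and> real d * u - t < of_int ?n + 1}"
  proof -
    have "{u. of_int ?n < real d * u - t \<and> real d * u - t < of_int ?n + 1}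
        = {u. real d \<bullet> u > of_int ?n + t} \<inter> {u. real d \<bullet> u < of_int ?n + 1 + t}"
      by auto
    moreover have "convex \<dots>"
      by (intro convex_Int convex_halfspace_gt convex_halfspace_lt)
    ultimately show ?thesis by simp
  qed
  have "circle_point u \<in> sphere 0 1 - circle_point ` ?L" if "u \<in> closed_segment x y" for u
  proof -
    have "of_int ?n < real d * u - t" "real d * u - t < of_int ?n + 1"
      using closed_segment_subset[OF _ _ conv, of x y] strict that by auto
    hence "real d * u - t \<notin> \<int>"
      by (auto elim!: Ints_cases)
    thus ?thesis
      using circle_point_in_image_iff[OF L] frac_in_critical_leaf_iff[OF t]
      by (auto simp: circle_point_def)
  qed
  hence "circle_point ` closed_segment x y \<subseteq> sphere 0 1 - circle_point ` ?L"
    by (rule image_subsetI)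
  moreover have "connected (circle_point ` closed_segment x y)"
    by (intro connected_continuous_image continuous_on_circle_point connected_segment)
  ultimately have "connected_component (sphere 0 1 - circle_point ` ?L) (circle_point x) (circle_point y)"
    unfolding connected_component_def
    by (intro exI[of _ "circle_point ` closed_segment x y"]) auto
  thus ?thesis by (simp add: separates_def)
qed

lemma separation_vector_singleton:
  "separation_vector {L} x y = (if separates L x y then [L] else [])"
proof (cases "separates L x y")
  case True
  hence leaves: "{L'\<in>{L}. separates L' x y} = {L}" by auto
  have single: "Ls = [L]" if "distinct Ls" "set Ls = {L}" for Ls
    using that distinct_card[of Ls] by (cases Ls) (auto simp: subset_singleton_iff)
  have "separation_vector {L} x y = [L]"
    unfolding separation_vector_def leaves
  proof (rule the_equality, goal_cases)
    case (2 Ls)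
    thus ?case using single[of Ls] by simp
  qed simp
  thus ?thesis using True by simp
next
  case False
  hence leaves: "{L'\<in>{L}. separates L' x y} = {}" by auto
  have "separation_vector {L} x y = []"
    unfolding separation_vector_def leaves
    by (rule the_equality) simp_all
  thus ?thesis using False by simp
qed

section \<open>Walks and eigenfunctions of finite graphs\<close>

primrec walk_count :: "('v \<Rightarrow> 'v list) \<Rightarrow> nat \<Rightarrow> 'v \<Rightarrow> nat" where
  "walk_count E 0 v = 1"
| "walk_count E (Suc n) v = sum_list (map (walk_count E n) (E v))"

lemma sum_list_map_eq_sum_count_mult:
  fixes f :: "'v \<Rightarrow> 'b::comm_semiring_1"
  assumes "finite V" "set xs \<subseteq> V"
  shows "sum_list (map f xs) = (\<Sum>w\<in>V. of_nat (count_list xs w) * f w)"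
  using assms(2)
proof (induction xs)
  case (Cons x xs)
  have "(\<Sum>w\<in>V. of_nat (count_list (x # xs) w) * f w)
      = (\<Sum>w\<in>V. (if w = x then f w else 0) + of_nat (count_list xs w) * f w)"
    by (intro sum.cong) (auto simp: algebra_simps)
  also have "\<dots> = f x + sum_list (map f xs)"
    using Cons assms(1) by (simp add: sum.distrib)
  finally show ?case by simp
qed simp

definition transition_matrix :: "'v list \<Rightarrow> ('v \<Rightarrow> 'v list) \<Rightarrow> complex Matrix.mat" where
  "transition_matrix vs E = Matrix.mat (length vs) (length vs)
     (\<lambda>(i, j). of_nat (count_list (E (vs ! i)) (vs ! j)))"

text \<open>
  The matrix acts on functions of the vertices by summation over outgoing edges; so eigenvectors
  can be handled as functions, independently of the enumeration \<open>vs\<close>.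
\<close>
lemma transition_matrix_mult_vec:
  fixes f :: "'v \<Rightarrow> complex"
  assumes vs: "distinct vs" and E: "\<And>v. v \<in> set vs \<Longrightarrow> set (E v) \<subseteq> set vs" and i: "i < length vs"
  shows "vec_index (mult_mat_vec (transition_matrix vs E) (Matrix.vec (length vs) (\<lambda>j. f (vs ! j)))) i
    = sum_list (map f (E (vs ! i)))"
proof -
  have "vec_index (mult_mat_vec (transition_matrix vs E) (Matrix.vec (length vs) (\<lambda>j. f (vs ! j)))) i
      = (\<Sum>j\<in>{..<length vs}. of_nat (count_list (E (vs ! i)) (vs ! j)) * f (vs ! j))"
    using i by (simp add: transition_matrix_def scalar_prod_def atLeast0LessThan)
  also have "\<dots> = (\<Sum>w\<in>set vs. of_nat (count_list (E (vs ! i)) w) * f w)"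
    by (rule sum.reindex_bij_betw[OF bij_betw_nth[OF vs refl refl]])
  also have "\<dots> = sum_list (map f (E (vs ! i)))"
    using sum_list_map_eq_sum_count_mult[OF _ E[of "vs ! i"], of f] i by simp
  finally show ?thesis .
qed

lemma transition_matrix_carrier: "transition_matrix vs E \<in> carrier_mat (length vs) (length vs)"
  by (simp add: transition_matrix_def)

lemma eigenfunction_le_spectral_radius:
  fixes f :: "'v \<Rightarrow> complex" and c :: complex
  assumes vs: "distinct vs" and E: "\<And>v. v \<in> set vs \<Longrightarrow> set (E v) \<subseteq> set vs"
    and eig: "\<And>v. v \<in> set vs \<Longrightarrow> sum_list (map f (E v)) = c * f v"
    and v: "v \<in> set vs" "f v \<noteq> 0"
  shows "norm c \<le> spectral_radius (transition_matrix vs E)"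
proof -
  let ?A = "transition_matrix vs E" and ?n = "length vs"
  define u where "u = Matrix.vec ?n (\<lambda>j. f (vs ! j))"
  obtain i where i: "i < ?n" "vs ! i = v" using v(1) by (auto simp: in_set_conv_nth)
  have "u \<noteq> 0\<^sub>v ?n"
  proof
    assume "u = 0\<^sub>v ?n"
    hence "vec_index u i = 0" using i by simp
    thus False using i v by (simp add: u_def)
  qed
  moreover have "mult_mat_vec ?A u = smult_vec c u"
  proof (rule eq_vecI)
    fix i assume "i < dim_vec (smult_vec c u)"
    hence i: "i < ?n" by (simp add: u_def)
    show "vec_index (mult_mat_vec ?A u) i = vec_index (smult_vec c u) i"
      using transition_matrix_mult_vec[OF vs E i, where f = f] eig[of "vs ! i"] i by (simp add: u_def)
  qed (simp add: u_def transition_matrix_def)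
  ultimately have "eigenvector ?A u c"
    by (simp add: eigenvector_def u_def transition_matrix_def)
  hence "c \<in> spectrum ?A"
    by (auto simp: spectrum_def eigenvalue_def)
  hence "norm c \<in> norm ` spectrum ?A" by (rule imageI)
  moreover have "0 < ?n" using i(1) by linarith
  ultimately show ?thesis
    by (intro spectral_radius_mem_max(2)[OF transition_matrix_carrier])
qed

text \<open>
  Iterating the eigenvalue equation writes \<open>c^n * f v\<close> as the sum of \<open>f\<close> over the endpoints
  of all walks of length \<open>n\<close> from \<open>v\<close>.
\<close>
lemma eigenfunction_walk_bound:
  fixes f :: "'v \<Rightarrow> complex"
  assumes E: "\<And>v. v \<in> V \<Longrightarrow> set (E v) \<subseteq> V"
    and eig: "\<And>v. v \<in> V \<Longrightarrow> sum_list (map f (E v)) = c * f v"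
    and B: "\<And>v. v \<in> V \<Longrightarrow> norm (f v) \<le> B"
  shows "v \<in> V \<Longrightarrow> norm c ^ n * norm (f v) \<le> real (walk_count E n v) * B"
proof (induction n arbitrary: v)
  case (Suc n)
  have list: "norm c ^ n * norm (sum_list (map f xs)) \<le> real (sum_list (map (walk_count E n) xs)) * B"
    if "set xs \<subseteq> V" for xs
    using that
  proof (induction xs)
    case (Cons x xs)
    have "norm c ^ n * norm (sum_list (map f (x # xs)))
        \<le> norm c ^ n * norm (f x) + norm c ^ n * norm (sum_list (map f xs))"
      by (simp add: norm_triangle_ineq mult_left_mono flip: distrib_left)
    also have "\<dots> \<le> real (walk_count E n x) * B + real (sum_list (map (walk_count E n) xs)) * B"
      using Cons Suc.IH[of x] by (intro add_mono) auto
    finally show ?case by (simp add: distrib_right)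
  qed simp
  have "norm c ^ Suc n * norm (f v) = norm c ^ n * norm (sum_list (map f (E v)))"
    using eig[OF Suc.prems] by (simp add: norm_mult mult_ac)
  also have "\<dots> \<le> real (walk_count E (Suc n) v) * B"
    using list[OF E[OF Suc.prems]] by simp
  finally show ?case .
qed (use B in auto)

text \<open>
  Apply the bound for walks at a vertex where an eigenfunction for an eigenvalue of maximal modulus
  is largest.
\<close>
lemma spectral_radius_power_le_walk_count:
  fixes E :: "'v \<Rightarrow> 'v list"
  assumes vs: "distinct vs" "vs \<noteq> []" and E: "\<And>v. v \<in> set vs \<Longrightarrow> set (E v) \<subseteq> set vs"
    and K: "\<And>v. v \<in> set vs \<Longrightarrow> walk_count E n v \<le> K"
  shows "0 \<le> spectral_radius (transition_matrix vs E)"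
    and "spectral_radius (transition_matrix vs E) ^ n \<le> real K"
proof -
  let ?A = "transition_matrix vs E" and ?n = "length vs"
  have "spectral_radius ?A \<in> norm ` spectrum ?A"
    using vs(2) by (intro spectral_radius_mem_max(1)[OF transition_matrix_carrier]) auto
  then obtain c where c: "spectral_radius ?A = norm c" "c \<in> spectrum ?A" by auto
  then obtain u where u: "eigenvector ?A u c"
    by (auto simp: spectrum_def eigenvalue_def)
  have dim: "dim_vec u = ?n" and u0: "u \<noteq> 0\<^sub>v ?n" and Au: "mult_mat_vec ?A u = smult_vec c u"
    using u by (auto simp: eigenvector_def transition_matrix_def)
  define f :: "'v \<Rightarrow> complex" where "f v = vec_index u (THE i. i < ?n \<and> vs ! i = v)" for v
  have f_nth: "f (vs ! i) = vec_index u i" if "i < ?n" for i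
  proof -
    have "(THE j. j < ?n \<and> vs ! j = vs ! i) = i"
      using that vs(1) by (intro the_equality) (auto simp: nth_eq_iff_index_eq)
    thus ?thesis by (simp add: f_def)
  qed
  have u_eq: "u = Matrix.vec ?n (\<lambda>j. f (vs ! j))"
    using f_nth by (intro eq_vecI) (auto simp: dim)
  have eig: "sum_list (map f (E v)) = c * f v" if v: "v \<in> set vs" for v
  proof -
    obtain i where i: "i < ?n" "vs ! i = v" using v by (auto simp: in_set_conv_nth)
    have "sum_list (map f (E v)) = vec_index (mult_mat_vec ?A u) i"
      using transition_matrix_mult_vec[OF vs(1) E i(1), where f = f] u_eq i by simp
    thus ?thesis using Au i f_nth[OF i(1)] dim by simp
  qed
  define B where "B = Max ((\<lambda>v. norm (f v)) ` set vs)"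
  have B: "norm (f v) \<le> B" if "v \<in> set vs" for v
    unfolding B_def using that by (intro Max_ge) auto
  have "B \<in> (\<lambda>v. norm (f v)) ` set vs"
    unfolding B_def using vs(2) by (intro Max_in) auto
  then obtain v where v: "v \<in> set vs" "B = norm (f v)" by blast
  have "0 < B"
  proof (rule ccontr)
    assume "\<not> 0 < B"
    hence "f w = 0" if "w \<in> set vs" for w
      using B[OF that] by (metis norm_le_zero_iff not_less order_trans)
    hence "u = 0\<^sub>v ?n"
      using f_nth by (intro eq_vecI) (auto simp: dim)
    thus False using u0 by simp
  qed
  have "norm c ^ n * B \<le> real (walk_count E n v) * B"
    using eigenfunction_walk_bound[of "set vs" E f c B v n] E eig B v by auto
  hence "norm c ^ n \<le> real (walk_count E n v)"
    using \<open>0 < B\<close> by simp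
  also have "\<dots> \<le> real K" using K[OF v(1)] by simp
  finally show "spectral_radius ?A ^ n \<le> real K" by (simp add: c(1))
  show "0 \<le> spectral_radius ?A" by (simp add: c(1))
qed

section \<open>The Thurston graph of a unicritical major\<close>

lemma thurston_matrix_eq:
  assumes "finite (thurston_vertices d M)"
  obtains vs where "distinct vs" "set vs = thurston_vertices d M"
    "thurston_matrix d M = transition_matrix vs (thurston_edges d M)"
proof -
  define vs where "vs = (SOME vs. distinct vs \<and> set vs = thurston_vertices d M)"
  have "\<exists>vs. distinct vs \<and> set vs = thurston_vertices d M"
    using finite_distinct_list[OF assms] by blast
  hence "distinct vs \<and> set vs = thurston_vertices d M"
    unfolding vs_def by (rule someI_ex)
  moreover have "thurston_matrix d M = transition_matrix vs (thurston_edges d M)"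
    by (simp add: thurston_matrix_def transition_matrix_def vs_def Let_def)
  ultimately show ?thesis using that by blast
qed

definition orbit :: "nat \<Rightarrow> real \<Rightarrow> nat \<Rightarrow> real" where
  "orbit d t n = (circle_map d ^^ n) t"

lemma orbit_0 [simp]: "orbit d t 0 = t" and orbit_Suc: "orbit d t (Suc n) = circle_map d (orbit d t n)"
  by (simp_all add: orbit_def)

lemma orbit_eq_frac:
  assumes "t \<in> circle"
  shows "orbit d t n = frac (real d ^ n * t)"
proof (induction n)
  case (Suc n)
  thus ?case by (simp add: orbit_Suc circle_map_frac mult.assoc)
qed (simp add: frac_circle[OF assms])

lemma thurston_vertices_critical_leaf:
  assumes "d > 0" "t \<in> circle"
  shows "thurston_vertices d {critical_leaf d t} = (\<lambda>(i, j). {orbit d t i, orbit d t j}) ` UNIV"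
proof -
  have "postcritical_set d {critical_leaf d t} = range (orbit d t)"
    using leaf_image_critical_leaf[OF assms] by (auto simp: postcritical_set_def orbit_def)
  thus ?thesis by (auto simp: thurston_vertices_def)
qed

lemma finite_thurston_vertices:
  assumes "d > 0" "t \<in> circle" "t \<in> \<rat>"
  shows "finite (thurston_vertices d {critical_leaf d t})"
proof -
  obtain a b where ab: "b > 0" "t = of_int a / of_int b"
    using assms(3) by (metis Rats_cases')
  have "range (orbit d t) \<subseteq> (\<lambda>k. real_of_int k / real_of_int b) ` {0..b}"
  proof (rule image_subsetI)
    fix n
    define k where "k = int d ^ n * a - b * \<lfloor>real d ^ n * t\<rfloor>"
    have "orbit d t n = real d ^ n * t - of_int \<lfloor>real d ^ n * t\<rfloor>"
      by (simp add: orbit_eq_frac[OF assms(2)] frac_def)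
    moreover have "real d ^ n * t = real d ^ n * of_int a / of_int b"
      by (simp add: ab(2))
    ultimately have o: "orbit d t n = real_of_int k / real_of_int b"
      using ab(1) by (simp add: k_def diff_divide_distrib)
    have "0 \<le> orbit d t n" "orbit d t n < 1"
      by (auto simp: orbit_eq_frac[OF assms(2)] frac_lt_1)
    hence "0 \<le> k" "k \<le> b"
      using ab(1) by (auto simp: o field_simps)
    thus "orbit d t n \<in> (\<lambda>k. real_of_int k / real_of_int b) ` {0..b}"
      using o by auto
  qed
  hence fin: "finite (range (orbit d t))"
    by (rule finite_subset) auto
  have "thurston_vertices d {critical_leaf d t} \<subseteq> (\<lambda>(x, y). {x, y}) ` (range (orbit d t) \<times> range (orbit d t))"
    by (auto simp: thurston_vertices_critical_leaf[OF assms(1,2)])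
  thus ?thesis
    by (rule finite_subset) (intro finite_imageI finite_cartesian_product fin)
qed

text \<open>
  As a multiset, the list of edges is symmetric in \<open>x\<close> and \<open>y\<close>, whichever of the two is smaller.
\<close>
lemma mset_thurston_edges:
  assumes "d > 0" "t \<in> circle"
  shows "mset (thurston_edges d {critical_leaf d t} {x, y}) =
    (if x \<noteq> y \<and> x \<in> critical_leaf d t \<and> y \<in> critical_leaf d t then {#}
     else if separates (critical_leaf d t) x y then {#{t, circle_map d x}, {t, circle_map d y}#}
     else {#{circle_map d x, circle_map d y}#})"
proof -
  let ?L = "critical_leaf d t"
  have le: "mset (thurston_edges d {?L} {x, y}) =
    (if x \<noteq> y \<and> x \<in> ?L \<and> y \<in> ?L then {#}
     else if separates ?L x y then {#{t, circle_map d x}, {t, circle_map d y}#}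
     else {#{circle_map d x, circle_map d y}#})" if "x \<le> y" for x y
    using that leaf_image_critical_leaf[OF assms]
    by (simp add: thurston_edges_def separation_vector_singleton insert_commute)
  show ?thesis
  proof (cases "x \<le> y")
    case False
    hence "mset (thurston_edges d {?L} {y, x}) =
      (if y \<noteq> x \<and> y \<in> ?L \<and> x \<in> ?L then {#}
       else if separates ?L y x then {#{t, circle_map d y}, {t, circle_map d x}#}
       else {#{circle_map d y, circle_map d x}#})"
      by (intro le) auto
    thus ?thesis
      by (simp add: insert_commute[of x y] insert_commute[of "circle_map d x"] separates_commute[of _ x y]
            add_mset_commute conj_commute eq_commute[of x y] cong: if_cong)
  qed (rule le)
qed

lemma sum_list_thurston_edges:
  fixes f :: "real set \<Rightarrow> 'b::comm_monoid_add"
  assumes "d > 0" "t \<in> circle"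
  shows "sum_list (map f (thurston_edges d {critical_leaf d t} {x, y})) =
    (if x \<noteq> y \<and> x \<in> critical_leaf d t \<and> y \<in> critical_leaf d t then 0
     else if separates (critical_leaf d t) x y then f {t, circle_map d x} + f {t, circle_map d y}
     else f {circle_map d x, circle_map d y})"
proof -
  have "sum_list (map f (thurston_edges d {critical_leaf d t} {x, y}))
      = sum_mset (image_mset f (mset (thurston_edges d {critical_leaf d t} {x, y})))"
    by (metis mset_map sum_mset_sum_list)
  thus ?thesis
    by (simp add: mset_thurston_edges[OF assms])
qed

lemma thurston_edges_closed:
  assumes "d > 0" "t \<in> circle" and v: "v \<in> thurston_vertices d {critical_leaf d t}"
  shows "set (thurston_edges d {critical_leaf d t} v) \<subseteq> thurston_vertices d {critical_leaf d t}"
proof -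
  obtain i j where ij: "v = {orbit d t i, orbit d t j}"
    using v by (auto simp: thurston_vertices_critical_leaf[OF assms(1,2)])
  have V: "{orbit d t k, orbit d t l} \<in> thurston_vertices d {critical_leaf d t}" for k l
    by (auto simp: thurston_vertices_critical_leaf[OF assms(1,2)])
  have "set (thurston_edges d {critical_leaf d t} v) = set_mset (mset (thurston_edges d {critical_leaf d t} v))"
    by simp
  also have "\<dots> \<subseteq> {{orbit d t 0, orbit d t (Suc i)}, {orbit d t 0, orbit d t (Suc j)},
      {orbit d t (Suc i), orbit d t (Suc j)}}"
    unfolding ij mset_thurston_edges[OF assms(1,2)] by (auto simp: orbit_Suc split: if_splits)
  also have "\<dots> \<subseteq> thurston_vertices d {critical_leaf d t}"
    using V by blast
  finally show ?thesis .
qed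

lemma walk_count_le_power:
  assumes "d > 0" "t \<in> circle" and v: "v \<in> thurston_vertices d {critical_leaf d t}"
  shows "walk_count (thurston_edges d {critical_leaf d t}) n v \<le> 2 ^ n"
  using v
proof (induction n arbitrary: v)
  case (Suc n)
  let ?w = "walk_count (thurston_edges d {critical_leaf d t})"
  obtain i j where ij: "v = {orbit d t i, orbit d t j}"
    using Suc.prems by (auto simp: thurston_vertices_critical_leaf[OF assms(1,2)])
  have "?w n {orbit d t k, orbit d t l} \<le> 2 ^ n" for k l
    by (rule Suc.IH) (auto simp: thurston_vertices_critical_leaf[OF assms(1,2)])
  from this[of 0 "Suc i"] this[of 0 "Suc j"] this[of "Suc i" "Suc j"] show ?case
    unfolding ij walk_count.simps sum_list_thurston_edges[OF assms(1,2)]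
    by (auto simp: orbit_Suc)
qed simp

text \<open>
  Two branching steps lead from any vertex to \<open>{t, x\<^sub>1}\<close>, and each further one from \<open>{t, x\<^sub>k}\<close> to
  \<open>{t, x\<^sub>k\<^sub>+\<^sub>1}\<close>. So a full binary tree of walks would contain the pair \<open>{t, x\<^sub>n}\<close> at level \<open>n + 1\<close>,
  where at most one edge goes on.
\<close>
lemma walk_count_deficient:
  assumes dt: "d > 0" "t \<in> circle" and v: "v \<in> thurston_vertices d {critical_leaf d t}"
    and n: "n \<ge> 1" "\<not> separates (critical_leaf d t) t (orbit d t n)"
  shows "walk_count (thurston_edges d {critical_leaf d t}) (n + 2) v \<le> 2 ^ (n + 2) - 1"
proof -
  let ?w = "walk_count (thurston_edges d {critical_leaf d t})"
  have le: "?w m {orbit d t k, orbit d t l} \<le> 2 ^ m" for m k l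
    by (rule walk_count_le_power[OF dt]) (auto simp: thurston_vertices_critical_leaf[OF dt])
  have pow: "(1::nat) \<le> 2 ^ m" for m by simp
  \<comment> \<open>Downward along the pairs \<open>{t, x\<^sub>n}\<close>, \<open>{t, x\<^sub>n\<^sub>-\<^sub>1}\<close>, and so on: each inherits the missing walk.\<close>
  have deficit: "?w (Suc r) {t, orbit d t (n - r)} \<le> 2 ^ Suc r - 1" if "r < n" for r
    using that
  proof (induction r)
    case 0
    show ?case
      using n(2) by (simp add: sum_list_thurston_edges[OF dt])
  next
    case (Suc r)
    have "Suc (n - Suc r) = n - r" using Suc.prems by simp
    hence next_orbit: "circle_map d (orbit d t (n - Suc r)) = orbit d t (n - r)"
      by (metis orbit_Suc)
    have "?w (Suc r) {t, circle_map d t} \<le> 2 ^ Suc r"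
      using le[of "Suc r" 0 1] by (simp add: orbit_Suc del: walk_count.simps)
    moreover have "?w (Suc r) {t, orbit d t (n - r)} \<le> 2 ^ Suc r - 1"
      using Suc by simp
    moreover have "?w (Suc r) {circle_map d t, orbit d t (n - r)} \<le> 2 ^ Suc r"
      using le[of "Suc r" 1 "n - r"] by (simp add: orbit_Suc del: walk_count.simps)
    moreover have "(2::nat) ^ Suc (Suc r) = 2 ^ Suc r + 2 ^ Suc r" by simp
    ultimately show ?case
      unfolding walk_count.simps(2)[of _ "Suc r"] sum_list_thurston_edges[OF dt] next_orbit
      using pow[of "Suc r"] by auto
  qed
  have first: "?w n {t, circle_map d t} \<le> 2 ^ n - 1"
    using deficit[of "n - 1"] n(1) by (simp add: orbit_Suc)
  have split: "?w (Suc n) {t, circle_map d (orbit d t k)} \<le> 2 ^ Suc n - 1" for k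
  proof -
    have "?w n {t, circle_map d (circle_map d (orbit d t k))} \<le> 2 ^ n"
      using le[of n 0 "Suc (Suc k)"] by (simp add: orbit_Suc)
    moreover have "?w n {circle_map d t, circle_map d (circle_map d (orbit d t k))} \<le> 2 ^ n"
      using le[of n 1 "Suc (Suc k)"] by (simp add: orbit_Suc)
    ultimately show ?thesis
      using first pow[of n] unfolding walk_count.simps(2)[of _ n] sum_list_thurston_edges[OF dt]
      by auto
  qed
  obtain i j where ij: "v = {orbit d t i, orbit d t j}"
    using v by (auto simp: thurston_vertices_critical_leaf[OF dt])
  have "?w (Suc n) {circle_map d (orbit d t i), circle_map d (orbit d t j)} \<le> 2 ^ Suc n"
    using le[of "Suc n" "Suc i" "Suc j"] by (simp add: orbit_Suc del: walk_count.simps)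
  moreover have "(2::nat) ^ (n + 2) = 2 ^ Suc n + 2 ^ Suc n" "n + 2 = Suc (Suc n)" by simp_all
  ultimately show ?thesis
    using split[of i] split[of j] pow[of "Suc n"]
    unfolding ij \<open>n + 2 = Suc (Suc n)\<close> walk_count.simps(2)[of _ "Suc n"] sum_list_thurston_edges[OF dt]
    by auto
qed

section \<open>Entropy bounds for rational angles\<close>

lemma rational_core_entropy_le:
  assumes d: "d > 0" and t: "t \<in> circle" "t \<in> \<rat>"
    and K: "\<And>v. v \<in> thurston_vertices d {critical_leaf d t} \<Longrightarrow>
        walk_count (thurston_edges d {critical_leaf d t}) N v \<le> K"
    and N: "N \<ge> 1" "K \<ge> 1"
  shows "rational_core_entropy d {critical_leaf d t} \<le> ln (real K) / real N"
proof -
  obtain vs where vs: "distinct vs" "set vs = thurston_vertices d {critical_leaf d t}"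
    "thurston_matrix d {critical_leaf d t} = transition_matrix vs (thurston_edges d {critical_leaf d t})"
    using thurston_matrix_eq[OF finite_thurston_vertices[OF d t]] by blast
  let ?r = "spectral_radius (thurston_matrix d {critical_leaf d t})"
  have "thurston_vertices d {critical_leaf d t} \<noteq> {}"
    by (auto simp: thurston_vertices_critical_leaf[OF d t(1)])
  hence ne: "vs \<noteq> []" using vs(2) by auto
  have r: "0 \<le> ?r" "?r ^ N \<le> real K"
    using spectral_radius_power_le_walk_count[OF vs(1) ne, of "thurston_edges d {critical_leaf d t}" N K]
      thurston_edges_closed[OF d t(1)] K unfolding vs(2,3) by auto
  \<comment> \<open>A nilpotent matrix has \<open>?r = 0\<close>, where \<open>ln 0 = 0\<close> still satisfies the bound.\<close>
  have "ln ?r \<le> ln (real K) / real N"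
  proof (cases "?r = 0")
    case False
    hence pos: "0 < ?r" using r(1) by simp
    have "real N * ln ?r = ln (?r ^ N)" by (simp add: ln_realpow pos)
    also have "\<dots> \<le> ln (real K)" using r(2) pos N by simp
    finally show ?thesis using N by (simp add: field_simps)
  qed (use N in simp)
  thus ?thesis by (simp add: rational_core_entropy_def)
qed

lemma rational_core_entropy_le_ln_2:
  assumes "d > 0" "t \<in> circle" "t \<in> \<rat>"
  shows "rational_core_entropy d {critical_leaf d t} \<le> ln 2"
  using rational_core_entropy_le[OF assms, of 1 2] walk_count_le_power[OF assms(1,2), of _ 1] by simp

text \<open>
  The exponential growth rate left when one of \<open>2^(n + 2)\<close> walks of length \<open>n + 2\<close> is missing.
\<close>
definition entropy_gap_bound :: "nat \<Rightarrow> real" where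
  "entropy_gap_bound n = ln (2 ^ (n + 2) - 1) / real (n + 2)"

lemma entropy_gap_bound_less: "entropy_gap_bound n < ln 2"
proof -
  have "(1::real) < 2 ^ (n + 2)" by (rule one_less_power) auto
  hence "ln (2 ^ (n + 2) - 1) < ln (2 ^ (n + 2) :: real)" by simp
  also have "\<dots> = real (n + 2) * ln 2" by (rule ln_realpow)
  finally show ?thesis by (simp add: entropy_gap_bound_def divide_less_eq mult.commute)
qed

lemma rational_core_entropy_le_gap_bound:
  assumes "d > 0" "t \<in> circle" "t \<in> \<rat>" "n \<ge> 1" "\<not> separates (critical_leaf d t) t (orbit d t n)"
  shows "rational_core_entropy d {critical_leaf d t} \<le> entropy_gap_bound n"
proof -
  have "(2::nat) ^ (n + 2) - 1 \<ge> 1"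
    using one_less_power[of "2::nat" "n + 2"] by linarith
  moreover have "real (2 ^ (n + 2) - 1) = 2 ^ (n + 2) - 1" by (simp add: of_nat_diff)
  ultimately show ?thesis
    using rational_core_entropy_le[OF assms(1-3), of "n + 2" "2 ^ (n + 2) - 1"]
      walk_count_deficient[OF assms(1,2) _ assms(4,5)] by (simp add: entropy_gap_bound_def)
qed

text \<open>
  The weight \<open>2^(-s)\<close> for the first time \<open>s\<close> at which the orbits of \<open>x\<close> and \<open>y\<close> are separated, and 0 if
  they never are. It acts as a length for which separated pairs have distance 1 and which doubles
  at every step before separation.
\<close>
definition separation_weight :: "nat \<Rightarrow> real set \<Rightarrow> real \<Rightarrow> real \<Rightarrow> complex" where
  "separation_weight d L x y =
    (if \<exists>n. separates L ((circle_map d ^^ n) x) ((circle_map d ^^ n) y)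
     then (1/2) ^ (LEAST n. separates L ((circle_map d ^^ n) x) ((circle_map d ^^ n) y)) else 0)"

lemma separation_weight_commute: "separation_weight d L x y = separation_weight d L y x"
  by (simp add: separation_weight_def separates_commute[of L "(circle_map d ^^ _) x"])

lemma separation_weight_separated: "separates L x y \<Longrightarrow> separation_weight d L x y = 1"
proof -
  assume sep: "separates L x y"
  hence "separates L ((circle_map d ^^ 0) x) ((circle_map d ^^ 0) y)" by simp
  hence "(LEAST n. separates L ((circle_map d ^^ n) x) ((circle_map d ^^ n) y)) = 0"
    by (metis (mono_tags, lifting) Least_eq_0)
  thus ?thesis
    using \<open>separates L ((circle_map d ^^ 0) x) ((circle_map d ^^ 0) y)\<close>
    by (auto simp: separation_weight_def intro: exI[of _ 0])
qed

lemma separation_weight_unseparated: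
  assumes "\<not> separates L x y"
  shows "2 * separation_weight d L x y = separation_weight d L (circle_map d x) (circle_map d y)"
proof -
  define P where "P n \<longleftrightarrow> separates L ((circle_map d ^^ n) x) ((circle_map d ^^ n) y)" for n
  have P0: "\<not> P 0" using assms by (simp add: P_def)
  have PSuc: "separates L ((circle_map d ^^ n) (circle_map d x)) ((circle_map d ^^ n) (circle_map d y)) \<longleftrightarrow> P (Suc n)" for n
    by (simp add: P_def funpow_swap1)
  have w1: "separation_weight d L x y = (if \<exists>n. P n then (1/2) ^ (LEAST n. P n) else 0)"
    by (simp add: separation_weight_def P_def)
  have w2: "separation_weight d L (circle_map d x) (circle_map d y)
      = (if \<exists>n. P (Suc n) then (1/2) ^ (LEAST n. P (Suc n)) else 0)"
    by (simp only: separation_weight_def PSuc)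
  show ?thesis
  proof (cases "\<exists>n. P n")
    case True
    then obtain n where n: "P n" by blast
    hence "\<exists>n. P (Suc n)" using P0 by (metis not0_implies_Suc)
    thus ?thesis
      using True Least_Suc[of P, OF n P0] by (simp add: w1 w2)
  next
    case False
    thus ?thesis by (simp add: w1 w2)
  qed
qed

text \<open>
  The separation weight is an eigenfunction for the eigenvalue 2. At an unseparated pair it doubles
  along the single edge. At a separated pair it is 1, and both edges lead to pairs \<open>{t, x\<^sub>n}\<close> with
  \<open>n \<ge> 1\<close>, where it is 1 again by hypothesis.
\<close>
lemma two_le_spectral_radius:
  assumes d: "d > 0" and t: "t \<in> circle" "t \<in> \<rat>"
    and sep: "\<And>n. n \<ge> 1 \<Longrightarrow> separates (critical_leaf d t) t (orbit d t n)"
  shows "2 \<le> spectral_radius (thurston_matrix d {critical_leaf d t})"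
proof -
  let ?L = "critical_leaf d t"
  obtain vs where vs: "distinct vs" "set vs = thurston_vertices d {?L}"
    "thurston_matrix d {?L} = transition_matrix vs (thurston_edges d {?L})"
    using thurston_matrix_eq[OF finite_thurston_vertices[OF d t]] by blast
  have L: "?L \<subseteq> circle" by (auto simp: critical_leaf_def)
  have orbit_circle: "orbit d t n \<in> circle" for n
    by (simp add: orbit_eq_frac[OF t(1)])
  have not_leaf: "orbit d t n \<notin> ?L" for n
  proof (cases n)
    case 0
    thus ?thesis
      using sep[of 1] separates_endpoint[OF L, of t "orbit d t 1"] frac_circle[OF t(1)] by auto
  next
    case (Suc m)
    thus ?thesis
      using sep[of n] separates_endpoint[OF L, of t "orbit d t n"] frac_circle[OF orbit_circle] by auto
  qed
  define f where "f v = separation_weight d ?L (Min v) (Max v)" for v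
  have f_pair: "f {x, y} = separation_weight d ?L x y" for x y
    by (cases "x \<le> y") (auto simp: f_def min_def max_def separation_weight_commute)
  have f_1: "f {t, circle_map d (orbit d t n)} = 1" for n
    using sep[of "Suc n"] by (simp add: f_pair separation_weight_separated orbit_Suc)
  have eig: "sum_list (map f (thurston_edges d {?L} v)) = 2 * f v" if v: "v \<in> set vs" for v
  proof -
    obtain i j where ij: "v = {orbit d t i, orbit d t j}"
      using v unfolding vs(2) by (auto simp: thurston_vertices_critical_leaf[OF d t(1)])
    show ?thesis
    proof (cases "separates ?L (orbit d t i) (orbit d t j)")
      case True
      thus ?thesis
        unfolding ij sum_list_thurston_edges[OF d t(1)]
        using not_leaf by (simp add: f_1) (simp add: f_pair separation_weight_separated)
    next
      case False
      thus ?thesis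
        unfolding ij sum_list_thurston_edges[OF d t(1)] f_pair
        using not_leaf by (simp add: separation_weight_unseparated)
    qed
  qed
  have "{orbit d t 0, orbit d t 1} \<in> set vs"
    unfolding vs(2) thurston_vertices_critical_leaf[OF d t(1)] by (intro image_eqI[of _ _ "(0, 1)"]) auto
  moreover have "f {orbit d t 0, orbit d t 1} \<noteq> 0"
    using f_1[of 0] by (simp add: orbit_Suc)
  ultimately have "norm (2::complex) \<le> spectral_radius (transition_matrix vs (thurston_edges d {?L}))"
    using thurston_edges_closed[OF d t(1)] vs(2) eig
    by (intro eigenfunction_le_spectral_radius[OF vs(1), of _ f]) auto
  thus ?thesis by (simp add: vs(3))
qed

section \<open>Orbits of the maximizing angles\<close>

lemma maximizing_angle_bounds:
  assumes "d \<ge> 3" "y \<in> nonzero_digits d"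
  shows "y / (real d * real d) < y / real d" "y / real d < (y / real d + 1) / real d"
proof -
  have y: "0 < y" "y \<le> 1"
    using nonzero_digits_bounds[OF assms] assms(1) by (auto intro: less_le_trans[of _ "1 / (real d - 1)"])
  show "y / (real d * real d) < y / real d"
    using y assms(1) by (intro divide_strict_left_mono) auto
  have "y * (real d - 1) \<le> 1 * (real d - 1)"
    using y assms(1) by (intro mult_right_mono) auto
  hence "y * real d < y + real d" using y by (simp add: algebra_simps)
  thus "y / real d < (y / real d + 1) / real d"
    using assms(1) by (simp add: field_simps)
qed

lemma maximizing_angles_subset_circle:
  assumes "d \<ge> 3"
  shows "maximizing_angles d \<subseteq> circle"
proof
  fix t assume "t \<in> maximizing_angles d"
  then obtain j y where jy: "j < d - 1" "y \<in> nonzero_digits d" "t = real j / (real d - 1) + y / real d"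
    by (auto simp: maximizing_angles_def)
  have y: "0 \<le> y" "y \<le> 1"
    using nonzero_digits_bounds[OF assms jy(2)] assms by (auto intro: order_trans[of _ "1 / (real d - 1)"])
  have "real j + 1 \<le> real d - 1" using jy(1) by linarith
  hence "(real j + 1) / (real d - 1) \<le> 1" using assms by simp
  moreover have "y / real d < 1 / (real d - 1)"
  proof -
    have "y / real d \<le> 1 / real d" using y assms by (intro divide_right_mono) auto
    also have "\<dots> < 1 / (real d - 1)" using assms by (intro divide_strict_left_mono) auto
    finally show ?thesis .
  qed
  moreover have "0 \<le> real j / (real d - 1)" "0 \<le> y / real d" using y assms by auto
  ultimately show "t \<in> circle"
    unfolding circle_def jy(3) add_divide_distrib by auto
qed

text \<open>
  Multiplication by \<open>d\<close> shifts the digits and fixes \<open>j / (d - 1)\<close> modulo 1.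
\<close>
lemma maximizing_orbit:
  assumes d: "d \<ge> 3" and y: "y \<in> nonzero_digits d"
    and t: "t = real j / (real d - 1) + y / real d" "t \<in> circle"
  shows "\<exists>z\<in>nonzero_digits d. orbit d t (Suc n) = frac (real j / (real d - 1) + z)"
proof (induction n)
  case 0
  have "real j / (real d - 1) * real d = real j / (real d - 1) + real j"
    using d by (simp add: field_simps)
  hence "real d * t - (real j / (real d - 1) + y) = of_int (int j)"
    using d by (simp add: t(1) algebra_simps)
  hence "frac (real d * t) = frac (real j / (real d - 1) + y)"
    by (metis Ints_of_int frac_eq_frac_iff)
  thus ?case using y by (auto simp: orbit_Suc circle_map_def)
next
  case (Suc n)
  then obtain z where z: "z \<in> nonzero_digits d" "orbit d t (Suc n) = frac (real j / (real d - 1) + z)"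
    by blast
  obtain k z' where z': "z' \<in> nonzero_digits d" "z = (real k + z') / real d"
    using z(1) nonzero_digits_self_similar[OF d] by blast
  have "real j / (real d - 1) * real d = real j / (real d - 1) + real j"
    using d by (simp add: field_simps)
  moreover have "real d * z = real k + z'" using z'(2) d by simp
  ultimately have "real d * (real j / (real d - 1) + z) - (real j / (real d - 1) + z') = of_int (int j + int k)"
    by (simp add: algebra_simps)
  hence "frac (real d * (real j / (real d - 1) + z)) = frac (real j / (real d - 1) + z')"
    by (metis Ints_of_int frac_eq_frac_iff)
  hence "orbit d t (Suc (Suc n)) = frac (real j / (real d - 1) + z')"
    by (simp add: orbit_Suc[of d t "Suc n"] z(2) circle_map_frac)
  thus ?case using z'(1) by blast
qed

text \<open>
  In lifted coordinates \<open>p\<close> and \<open>q\<close> are the endpoints of the sector around \<open>t\<close>. The inequality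
  \<open>(1/d + 1)/d < 1/(d - 1)\<close> says that the sector ends before the smallest number whose
  digits are all nonzero.
\<close>
lemma maximizing_angle_separates:
  assumes d: "d \<ge> 3" and tm: "t \<in> maximizing_angles d" and n: "n \<ge> 1"
  shows "separates (critical_leaf d t) t (orbit d t n)"
proof -
  obtain j y where jy: "y \<in> nonzero_digits d" "t = real j / (real d - 1) + y / real d"
    using tm by (auto simp: maximizing_angles_def)
  have t: "t \<in> circle" using tm maximizing_angles_subset_circle[OF d] by blast
  obtain z where z: "z \<in> nonzero_digits d" "orbit d t n = frac (real j / (real d - 1) + z)"
    using maximizing_orbit[OF d jy t, of "n - 1"] n by auto
  define b where "b = real j / (real d - 1)"
  define p where "p = b + y / real d / real d"
  define q where "q = b + (y / real d + 1) / real d"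
  have bd: "real d * b = b + real j"
    using d by (simp add: b_def field_simps)
  have tb: "t = b + y / real d" using jy(2) by (simp add: b_def)
  have L: "critical_leaf d t \<subseteq> circle" by (auto simp: critical_leaf_def)
  have y: "0 < y" "y \<le> 1" and z01: "1 / (real d - 1) \<le> z" "z \<le> 1"
    using nonzero_digits_bounds[OF d jy(1)] nonzero_digits_bounds[OF d z(1)] d
    by (auto intro: less_le_trans[of _ "1 / (real d - 1)"])
  have order: "p < t" "t < q"
    using maximizing_angle_bounds[OF d jy(1)] by (simp_all add: p_def q_def tb)
  have "(y / real d + 1) / real d \<le> (1 / real d + 1) / real d"
    using y d by (intro divide_right_mono add_right_mono) auto
  also have "\<dots> < 1 / (real d - 1)"
    using d by (simp add: field_simps)
  finally have qz: "q < b + z" using z01 by (simp add: q_def)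
  have zp: "b + z < p + 1"
  proof -
    have "0 < y / real d / real d" using y d by simp
    thus ?thesis using z01 by (simp add: p_def)
  qed
  have qp: "real d * q = real d * p + 1" using d by (simp add: p_def q_def field_simps)
  have dp: "real d * p = t + real j" using d by (simp add: p_def distrib_left bd tb)
  have ints: "real d * p - t \<in> \<int>" "real d * q - t \<in> \<int>"
    by (simp_all add: qp dp)
  have not_int: "real m + u \<notin> \<int>" if "0 < u" "u < 1" for m :: nat and u :: real
  proof
    assume "real m + u \<in> \<int>"
    hence "u \<in> \<int>" using Ints_diff[of "real m + u" "real m"] by simp
    thus False using that by (auto elim!: Ints_cases)
  qed
  obtain k z' where z': "z' \<in> nonzero_digits d" "z = (real k + z') / real d"
    using z(1) nonzero_digits_self_similar[OF d] by blast
  have "1 / real d < 1 / (real d - 1)" "y / real d \<le> 1 / real d" "0 < y / real d"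
    using d y by (auto intro!: divide_strict_left_mono divide_right_mono)
  hence "0 < z' - y / real d" "z' - y / real d < 1"
    using nonzero_digits_bounds[OF d z'(1)] by linarith+
  moreover have "real d * z = real k + z'" using z'(2) d by simp
  hence "real d * (b + z) - t = real (j + k) + (z' - y / real d)"
    by (simp add: distrib_left bd tb)
  ultimately have "frac (b + z) \<notin> critical_leaf d t"
    by (simp only: frac_in_critical_leaf_iff[OF t] not_int not_False_eq_True)
  moreover have "frac t \<notin> critical_leaf d t"
  proof -
    have "0 < y - y / real d" "y - y / real d < 1"
      using y d \<open>0 < y / real d\<close> by (simp add: field_simps, linarith)
    moreover have "real d * t - t = real j + (y - y / real d)"
      using d by (simp add: tb distrib_left bd)
    ultimately show ?thesis
      by (simp only: frac_in_critical_leaf_iff[OF t] not_int not_False_eq_True)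
  qed
  moreover have "frac p \<in> critical_leaf d t" "frac q \<in> critical_leaf d t"
    using ints by (simp_all add: frac_in_critical_leaf_iff[OF t])
  ultimately have "separates (critical_leaf d t) t (b + z)"
    using order qz zp by (intro separates_between[OF L, of p q])
  thus ?thesis by (simp add: z(2) b_def)
qed

section \<open>Orbits of the other angles\<close>

text \<open>
  The inequalities say that the lift \<open>d^n * t - c\<close> of \<open>x\<^sub>n\<close> lies in the open sector of \<open>t\<close>, compare
  \<open>not_separates_same_floor\<close>; being strict, they persist for nearby angles. The exceptional
  angles with \<open>(d - 1) * t\<close> an integer are the fixed points of multiplication by \<open>d\<close>.

  Suppose that the orbit never enters the sector. Relative to the fixed point \<open>b\<close> just below \<open>t\<close>, the
  points \<open>x\<^sub>n\<close> then have lifts in the complementary interval \<open>[lo, hi]\<close>. Successive lifts are related by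
  \<open>y' = d * y - k\<close> with an integer \<open>k\<close>, and the endpoints of the interval force \<open>0 < k < d\<close>. So all
  lifts have expansions with nonzero digits, and \<open>t - b\<close> itself has the leading digit 0.
\<close>
lemma escaping_angle:
  assumes d: "d \<ge> 3" and t: "t \<in> circle" "t \<notin> maximizing_angles d" "(real d - 1) * t \<notin> \<int>"
  obtains n c where "n \<ge> 1"
    "of_int \<lfloor>(real d - 1) * t\<rfloor> < real d * (real d ^ n * t - of_int c) - t"
    "real d * (real d ^ n * t - of_int c) - t < of_int \<lfloor>(real d - 1) * t\<rfloor> + 1"
proof (rule ccontr)
  assume "\<not> thesis"
  note none = this and escape = that
  define j where "j = \<lfloor>(real d - 1) * t\<rfloor>"
  have "(real d - 1) * t \<noteq> of_int j" using t(3) by (metis Ints_of_int)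
  hence j: "of_int j < (real d - 1) * t" "(real d - 1) * t < of_int j + 1"
    unfolding j_def by linarith+
  define b where "b = of_int j / (real d - 1)"
  have bd: "real d * b = b + of_int j" using d by (simp add: b_def field_simps)
  define t0 where "t0 = t - b"
  have "(real d - 1) * b = of_int j" using d by (simp add: b_def)
  hence t0: "0 < (real d - 1) * t0" "(real d - 1) * t0 < 1"
    using j by (simp_all add: t0_def right_diff_distrib)
  have t0_pos: "0 < t0" using t0(1) d by (simp add: zero_less_mult_iff)
  have t0_d: "real d * t0 < 1 + t0" using t0(2) by (simp add: algebra_simps)
  define lo where "lo = (1 + t0) / real d"
  define hi where "hi = 1 + t0 / real d"
  have dlo: "real d * lo = 1 + t0"
    using d by (simp add: lo_def)
  have dhi: "real d * hi = real d + t0"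
    using d by (simp add: hi_def distrib_left)
  have t0_div: "0 < t0 / real d" "t0 / real d < t0" "t0 < lo"
    using t0_pos t0_d d by (simp_all add: lo_def field_simps)
  have lo_pos: "0 < lo" using t0_pos d by (simp add: lo_def)
  have t0_lt_1: "t0 < 1"
  proof -
    have "2 * t0 \<le> (real d - 1) * t0" using d t0_pos by (intro mult_right_mono) auto
    thus ?thesis using t0(2) t0_pos by linarith
  qed
  have hi_le: "hi \<le> 2" using t0_div t0_lt_1 by (simp add: hi_def)
  define w where "w n c = real d ^ n * t - b - of_int c" for n and c :: int
  have avoid: "w n c \<le> t0 / real d \<or> lo \<le> w n c" if "n \<ge> 1" for n c
  proof (rule ccontr)
    assume "\<not> ?thesis"
    hence lt: "t0 / real d < w n c" "w n c < lo" by auto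
    have "real d * (t0 / real d) < real d * w n c" "real d * w n c < real d * lo"
      using mult_strict_left_mono[OF lt(1), of "real d"] mult_strict_left_mono[OF lt(2), of "real d"] d
      by linarith+
    moreover have "real d * w n c - t0 = real d * (real d ^ n * t - of_int c) - t - of_int j"
      by (simp add: w_def right_diff_distrib bd t0_def)
    ultimately have "of_int j < real d * (real d ^ n * t - of_int c) - t"
      "real d * (real d ^ n * t - of_int c) - t < of_int j + 1"
      using d dlo by auto
    thus False using none escape[OF \<open>n \<ge> 1\<close>] unfolding j_def by blast
  qed
  have lift: "\<exists>c. lo \<le> w n c \<and> w n c \<le> hi" if "n \<ge> 1" for n
  proof -
    define c where "c = \<lceil>real d ^ n * t - b - t0 / real d\<rceil> - 1"
    have "t0 / real d < w n c" "w n c \<le> hi"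
      unfolding w_def hi_def c_def by linarith+
    thus ?thesis using avoid[OF that, of c] by (intro exI[of _ c]) auto
  qed
  have digits: "y \<in> nonzero_digits d" if "\<exists>n c. n \<ge> 1 \<and> y = w n c \<and> lo \<le> y \<and> y \<le> hi" for y
    using that
  proof (coinduction arbitrary: y rule: nonzero_digits.coinduct)
    case (nonzero_digits y)
    then obtain n c where n: "n \<ge> 1" "y = w n c" "lo \<le> y" "y \<le> hi" by blast
    obtain c' where c': "lo \<le> w (Suc n) c'" "w (Suc n) c' \<le> hi"
      using lift[of "Suc n"] by auto
    define k where "k = c' - j - int d * c"
    have k: "real d * y - of_int k = w (Suc n) c'"
      by (simp add: n(2) w_def k_def right_diff_distrib bd)
    have "real d * lo \<le> real d * y" "real d * y \<le> real d * hi"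
      using n by (auto intro: mult_left_mono)
    hence "0 < real_of_int k" "real_of_int k < real d"
      using k c' dlo dhi t0_div unfolding hi_def by linarith+
    hence kd: "1 \<le> k" "k < int d" by linarith+
    have "real d * y - real (nat k) = w (Suc n) c'" using k kd(1) by simp
    moreover have "nat k \<in> {1..<d}" using kd by auto
    ultimately show ?case
      using n lo_pos hi_le c'
      by (intro exI[of _ y] exI[of _ "nat k"]) (auto intro!: exI[of _ "Suc n"])
  qed
  obtain c1 where c1: "lo \<le> w 1 c1" "w 1 c1 \<le> hi" using lift[of 1] by auto
  have eq: "real d * t0 - w 1 c1 = of_int (c1 - j)"
    by (simp add: w_def t0_def right_diff_distrib bd)
  have "t0 * real d < lo + 1"
  proof -
    have "real d * t0 < 1 + lo" using t0_d t0_div(3) by linarith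
    thus ?thesis by (simp add: mult.commute)
  qed
  moreover have "hi - 1 < real d * t0"
  proof -
    have "1 * t0 \<le> real d * t0" using d t0_pos by (intro mult_right_mono) auto
    thus ?thesis using t0_div unfolding hi_def by linarith
  qed
  ultimately have "-1 < real_of_int (c1 - j)" "real_of_int (c1 - j) < 1"
    using eq c1 by (simp_all add: mult.commute)
  hence "c1 - j = 0" by linarith
  hence "t0 = w 1 c1 / real d" using eq d by (simp add: field_simps)
  moreover have "w 1 c1 \<in> nonzero_digits d" using c1 by (intro digits) auto
  moreover have "0 \<le> j" "j < int d - 1"
  proof -
    have "0 \<le> (real d - 1) * t" "(real d - 1) * t < (real d - 1) * 1"
      using t(1) d unfolding circle_def by (auto simp del: mult_1_right intro!: mult_strict_left_mono)
    hence "0 < real_of_int j + 1" "real_of_int j < real d - 1" using j by auto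
    thus "0 \<le> j" "j < int d - 1" by linarith+
  qed
  moreover have "t = real (nat j) / (real d - 1) + t0"
    using \<open>0 \<le> j\<close> by (simp add: t0_def b_def)
  ultimately have "t \<in> maximizing_angles d"
    unfolding maximizing_angles_def by (intro UN_I[of "nat j"] image_eqI[of _ _ "w 1 c1"]) auto
  thus False using t(2) by simp
qed

section \<open>Topology of the unicritical stratum\<close>

lemma arc_dist_le_lift:
  assumes "u \<in> circle" "v \<in> circle" "u - v - w \<in> \<int>"
  shows "arc_dist u v \<le> \<bar>w\<bar>"
proof -
  obtain n :: int where n: "u - v - w = of_int n" using assms(3) by (auto elim: Ints_cases)
  have uv: "\<bar>u - v\<bar> < 1" using assms by (auto simp: circle_def)
  show ?thesis
  proof (cases "n = 0")
    case True
    thus ?thesis using n by (simp add: arc_dist_def)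
  next
    case False
    hence "1 \<le> \<bar>real_of_int n\<bar>" by linarith
    hence "1 - \<bar>u - v\<bar> \<le> \<bar>w\<bar>" using n by linarith
    thus ?thesis by (simp add: arc_dist_def)
  qed
qed

text \<open>
  Arc length is the least of the numbers \<open>\<bar>x - y + n\<bar>\<close> for integers \<open>n\<close>, of which only
  \<open>n = -1, 0, 1\<close> matter; the difference \<open>x - y\<close> changes only by an integer under rotation.
\<close>
lemma arc_dist_rotate:
  assumes "x \<in> circle" "y \<in> circle"
  shows "arc_dist (frac (x + r)) (frac (y + r)) \<le> arc_dist x y"
proof -
  have *: "frac (x + r) - frac (y + r) - (x - y + of_int n) \<in> \<int>" for n :: int
    by (simp add: frac_def)
  have "arc_dist (frac (x + r)) (frac (y + r)) \<le> \<bar>x - y + of_int n\<bar>" for n :: int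
    by (rule arc_dist_le_lift[OF _ _ *]) auto
  from this[of 0] this[of 1] this[of "-1"] show ?thesis
    using assms by (auto simp: arc_dist_def circle_def abs_if split: if_splits)
qed

text \<open>
  Rotation by \<open>r = (t' - t) / d\<close> carries one leaf to the other, so it pulls the pseudometric of the
  second back to an admissible one for the first. A point and its rotated image are at most \<open>\<bar>r\<bar>\<close>
  apart.
\<close>
lemma major_pseudometric_rotate_le:
  assumes t: "t \<in> circle" "t' \<in> circle" and d: "d > 0" and xy: "x \<in> circle" "y \<in> circle"
  shows "major_pseudometric {critical_leaf d t'} x y
    \<le> major_pseudometric {critical_leaf d t} x y + 2 * \<bar>t' - t\<bar>"
proof -
  define r where "r = (t' - t) / real d"
  define R where "R u = frac (u + r)" for u
  let ?D' = "major_pseudometric {critical_leaf d t'}"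
  have R: "R u \<in> circle" for u by (simp add: R_def)
  have adm': "?D' \<in> admissible_pseudometrics {critical_leaf d t'}"
    by (rule major_pseudometric_admissible) (auto simp: critical_leaf_def)
  have arc': "?D' u v \<le> arc_dist u v" if "u \<in> circle" "v \<in> circle" for u v
    using adm' that by (auto simp: admissible_pseudometrics_def)
  have tri: "?D' u w \<le> ?D' u v + ?D' v w" if "u \<in> circle" "v \<in> circle" "w \<in> circle" for u v w
    using adm' that by (auto simp: admissible_pseudometrics_def pseudometric_on_def)
  have R_leaf: "R u \<in> critical_leaf d t'" if u: "u \<in> critical_leaf d t" for u
  proof -
    have "frac u \<in> critical_leaf d t" using u frac_circle by (auto simp: critical_leaf_def)
    hence "real d * u - t \<in> \<int>" by (simp add: frac_in_critical_leaf_iff[OF t(1)])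
    moreover have "real d * (u + r) - t' = real d * u - t"
      using d by (simp add: r_def distrib_left)
    ultimately show ?thesis by (simp add: R_def frac_in_critical_leaf_iff[OF t(2)])
  qed
  have "(\<lambda>u v. ?D' (R u) (R v)) \<in> admissible_pseudometrics {critical_leaf d t}"
  proof -
    have "?D' (R u) (R v) \<le> arc_dist u v" if "u \<in> circle" "v \<in> circle" for u v
      using arc'[OF R R, of u v] arc_dist_rotate[OF that, of r] by (simp add: R_def)
    thus ?thesis
      using adm' R R_leaf by (auto simp: admissible_pseudometrics_def pseudometric_on_def)
  qed
  hence rotated: "?D' (R x) (R y) \<le> major_pseudometric {critical_leaf d t} x y"
    using xy by (rule major_pseudometric_upper)
  have near: "?D' u (R u) \<le> \<bar>r\<bar>" "?D' (R u) u \<le> \<bar>r\<bar>" if "u \<in> circle" for u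
  proof -
    have "arc_dist (R u) u \<le> \<bar>r\<bar>"
      by (rule arc_dist_le_lift[OF R that]) (simp add: R_def frac_def)
    thus "?D' u (R u) \<le> \<bar>r\<bar>" "?D' (R u) u \<le> \<bar>r\<bar>"
      using arc'[OF that R, of u] arc'[OF R that, of u] by (simp_all add: arc_dist_commute[of u])
  qed
  have "\<bar>r\<bar> \<le> \<bar>t' - t\<bar>"
    using d by (simp add: r_def abs_divide divide_le_eq mult_le_cancel_left1)
  moreover have "?D' x y \<le> \<bar>r\<bar> + (major_pseudometric {critical_leaf d t} x y + \<bar>r\<bar>)"
    using tri[OF xy(1) R[of x] xy(2)] tri[OF R[of x] R[of y] xy(2)] near(1)[OF xy(1)] near(2)[OF xy(2)]
      rotated by (meson add_mono order_trans)
  moreover have "\<bar>r\<bar> + (a + \<bar>r\<bar>) \<le> a + 2 * c" if "\<bar>r\<bar> \<le> c" for a c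
    using that by simp
  ultimately show ?thesis by (meson order_trans)
qed

lemma major_dist_critical_leaf_le:
  assumes "t \<in> circle" "t' \<in> circle" "d > 0"
  shows "major_dist {critical_leaf d t} {critical_leaf d t'} \<le> 2 * \<bar>t' - t\<bar>"
proof (rule major_dist_least)
  fix x y assume "x \<in> circle" "y \<in> circle"
  from major_pseudometric_rotate_le[OF assms this] major_pseudometric_rotate_le[OF assms(2,1,3) this]
  show "\<bar>major_pseudometric {critical_leaf d t} x y - major_pseudometric {critical_leaf d t'} x y\<bar>
    \<le> 2 * \<bar>t' - t\<bar>" unfolding abs_minus_commute[of t t'] by linarith
qed

lemma continuous_map_critical_leaf:
  assumes d: "d \<ge> 2"
  shows "continuous_map (top_of_set circle) (majors_topology d) (\<lambda>t. {critical_leaf d t})"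
proof -
  interpret Metric_space "primitive_majors d" major_dist
    by (rule Metric_space_primitive_majors)
  note mem = critical_leaf_primitive_major[OF d]
  show ?thesis
    unfolding majors_topology_def continuous_map_to_metric
  proof (intro ballI allI impI)
    fix t and e :: real assume "t \<in> topspace (top_of_set circle)" "e > 0"
    hence t: "t \<in> circle" by simp
    have "{critical_leaf d s} \<in> mball {critical_leaf d t} e" if "s \<in> circle \<inter> ball t (e / 2)" for s
      using that t mem major_dist_critical_leaf_le[OF t, of s d] d
      by (auto simp: dist_real_def abs_minus_commute)
    thus "\<exists>U. openin (top_of_set circle) U \<and> t \<in> U \<and> (\<forall>s\<in>U. {critical_leaf d s} \<in> mball {critical_leaf d t} e)"
      using t \<open>e > 0\<close> by (intro exI[of _ "circle \<inter> ball t (e / 2)"]) (auto intro: openin_open_Int)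
  qed
qed

section \<open>Maxima of core entropy\<close>

lemma continuous_on_approx_closed:
  fixes g :: "real \<Rightarrow> real"
  assumes "continuous_on S g" "x \<in> S" "closed C"
    and approx: "\<And>e. e > 0 \<Longrightarrow> \<exists>y\<in>S. \<bar>y - x\<bar> < e \<and> g y \<in> C"
  shows "g x \<in> C"
proof -
  have "\<exists>c\<in>C. dist c (g x) < e" if "e > 0" for e
  proof -
    obtain a where a: "a > 0" "\<And>y. y \<in> S \<Longrightarrow> dist y x < a \<Longrightarrow> dist (g y) (g x) < e"
      using assms(1,2) \<open>e > 0\<close> unfolding continuous_on_iff by metis
    obtain y where "y \<in> S" "\<bar>y - x\<bar> < a" "g y \<in> C" using approx[OF a(1)] by blast
    thus ?thesis using a(2)[of y] by (auto simp: dist_real_def)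
  qed
  hence "g x \<in> closure C" by (simp add: closure_approachable)
  thus ?thesis using assms(3) by simp
qed

lemma rational_dense_circle:
  assumes "t \<in> circle" "e > 0"
  shows "\<exists>s\<in>circle \<inter> \<rat>. \<bar>s - t\<bar> < e"
proof -
  have "t < min (t + e) 1" using assms by (auto simp: circle_def)
  then obtain s where "s \<in> \<rat>" "t < s" "s < min (t + e) 1" using Rats_dense_in_real by blast
  thus ?thesis using assms(1) by (intro bexI[of _ s]) (auto simp: circle_def)
qed

context
  fixes d :: nat and h :: "real set set \<Rightarrow> real"
  assumes d: "d \<ge> 3" and h: "is_core_entropy d h"
begin

lemma continuous_on_core_entropy: "continuous_on circle (\<lambda>t. h {critical_leaf d t})"
proof -
  have "continuous_map (top_of_set circle) euclideanreal (h \<circ> (\<lambda>t. {critical_leaf d t}))"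
    using h d by (intro continuous_map_compose[OF continuous_map_critical_leaf]) (auto simp: is_core_entropy_def)
  thus ?thesis by (simp add: o_def)
qed

lemma core_entropy_rational:
  assumes "t \<in> circle" "t \<in> \<rat>"
  shows "h {critical_leaf d t} = rational_core_entropy d {critical_leaf d t}"
proof -
  have "{critical_leaf d t} \<in> primitive_majors d"
    using assms(1) d by (intro critical_leaf_primitive_major) auto
  moreover have "critical_leaf d t \<subseteq> \<rat>"
    using d by (intro critical_leaf_rational assms) auto
  ultimately have "{critical_leaf d t} \<in> rational_primitive_majors d"
    unfolding rational_primitive_majors_def by simp
  thus ?thesis using h by (simp add: is_core_entropy_def)
qed

text \<open>
  Rational angles are dense within the set of maximizing angles, not only in the circle; hence the
  value at irrational ones is a limit of the value \<open>ln 2\<close>.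
\<close>
lemma core_entropy_maximizing:
  assumes t: "t \<in> maximizing_angles d"
  shows "h {critical_leaf d t} = ln 2"
proof -
  note sub = maximizing_angles_subset_circle[OF d]
  have rational: "h {critical_leaf d s} = ln 2" if s: "s \<in> maximizing_angles d" "s \<in> \<rat>" for s
  proof -
    have sc: "s \<in> circle" using s sub by blast
    have d0: "d > 0" using d by simp
    have "2 \<le> spectral_radius (thurston_matrix d {critical_leaf d s})"
      using two_le_spectral_radius[OF d0 sc s(2)] maximizing_angle_separates[OF d s(1)] by simp
    hence "ln 2 \<le> rational_core_entropy d {critical_leaf d s}"
      by (simp add: rational_core_entropy_def)
    thus ?thesis
      using rational_core_entropy_le_ln_2[OF d0 sc s(2)] core_entropy_rational[OF sc s(2)] by simp
  qed
  have "h {critical_leaf d t} \<in> {ln 2}"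
  proof (rule continuous_on_approx_closed[OF continuous_on_core_entropy])
    fix e :: real assume "e > 0"
    then obtain s where "s \<in> maximizing_angles d" "s \<in> \<rat>" "\<bar>s - t\<bar> < e"
      using maximizing_angles_rational_dense[OF d t] by blast
    thus "\<exists>s\<in>circle. \<bar>s - t\<bar> < e \<and> h {critical_leaf d s} \<in> {ln 2}"
      using rational sub by blast
  qed (use t sub in auto)
  thus ?thesis by simp
qed

text \<open>
  At a fixed point the angle is rational and the pair \<open>{t, x\<^sub>1} = {t}\<close> is not separated. Otherwise the
  same \<open>n\<close> works in a neighbourhood \<open>U\<close> of \<open>t\<close>, so that the gap bound passes to the limit.
\<close>
lemma core_entropy_not_maximizing:
  assumes t: "t \<in> circle" "t \<notin> maximizing_angles d"
  shows "h {critical_leaf d t} < ln 2"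
proof -
  have d0: "d > 0" using d by simp
  have "\<exists>n. h {critical_leaf d t} \<le> entropy_gap_bound n"
  proof (cases "(real d - 1) * t \<in> \<int>")
    case True
    have "t = ((real d - 1) * t) / (real d - 1)" using d by simp
    moreover have "(real d - 1) * t \<in> \<rat>" using True Ints_subset_Rats by blast
    ultimately have rat: "t \<in> \<rat>" by (metis Rats_1 Rats_diff Rats_divide Rats_of_nat)
    have "real d * t - t \<in> \<int>" using True by (simp add: left_diff_distrib)
    hence "orbit d t 1 = t"
      using frac_eq_frac_iff[of "real d * t" t] by (simp add: orbit_eq_frac[OF t(1)] frac_circle[OF t(1)])
    hence "rational_core_entropy d {critical_leaf d t} \<le> entropy_gap_bound 1"
      using not_separates_refl by (intro rational_core_entropy_le_gap_bound[OF d0 t(1) rat]) auto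
    thus ?thesis using core_entropy_rational[OF t(1) rat] by auto
  next
    case False
    define j where "j = \<lfloor>(real d - 1) * t\<rfloor>"
    obtain n c where n: "n \<ge> 1" and nc: "of_int j < real d * (real d ^ n * t - of_int c) - t"
      "real d * (real d ^ n * t - of_int c) - t < of_int j + 1"
      using escaping_angle[OF d t False] unfolding j_def by blast
    have "(real d - 1) * t \<noteq> of_int j" using False by (metis Ints_of_int)
    hence jt: "of_int j < real d * t - t" "real d * t - t < of_int j + 1"
      unfolding j_def left_diff_distrib by (simp_all, linarith+)
    define U where "U = {s. of_int j < real d * (real d ^ n * s - of_int c) - s} \<inter>
      {s. real d * (real d ^ n * s - of_int c) - s < of_int j + 1} \<inter>
      {s. of_int j < real d * s - s} \<inter> {s. real d * s - s < of_int j + 1}"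
    have "open U"
      unfolding U_def by (intro open_Int open_Collect_less continuous_intros)
    moreover have "t \<in> U" using nc jt by (simp add: U_def)
    ultimately obtain a where a: "a > 0" "\<And>s. dist s t < a \<Longrightarrow> s \<in> U"
      unfolding open_dist by blast
    have bound: "h {critical_leaf d s} \<le> entropy_gap_bound n" if s: "s \<in> circle" "s \<in> \<rat>" "s \<in> U" for s
    proof -
      have "\<lfloor>real d * s - s\<rfloor> = j" "\<lfloor>real d * (real d ^ n * s - of_int c) - s\<rfloor> = j"
        using s(3) by (auto simp: U_def floor_eq_iff)
      hence "\<not> separates (critical_leaf d s) s (real d ^ n * s - of_int c)"
        by (intro not_separates_same_floor[OF s(1)]) simp
      moreover have "orbit d s n = frac (real d ^ n * s - of_int c)"
        by (simp add: orbit_eq_frac[OF s(1)] frac_eq_frac_iff)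
      ultimately have "\<not> separates (critical_leaf d s) s (orbit d s n)" by simp
      thus ?thesis
        using rational_core_entropy_le_gap_bound[OF d0 s(1,2) n] core_entropy_rational[OF s(1,2)] by simp
    qed
    have "h {critical_leaf d t} \<in> {..entropy_gap_bound n}"
    proof (rule continuous_on_approx_closed[OF continuous_on_core_entropy t(1)])
      fix e :: real assume "e > 0"
      then obtain s where "s \<in> circle" "s \<in> \<rat>" "\<bar>s - t\<bar> < min e a"
        using rational_dense_circle[OF t(1), of "min e a"] a(1) by auto
      thus "\<exists>s\<in>circle. \<bar>s - t\<bar> < e \<and> h {critical_leaf d s} \<in> {..entropy_gap_bound n}"
        using bound a(2)[of s] by (intro bexI[of _ s]) (auto simp: dist_real_def)
    qed simp
    thus ?thesis by auto
  qed
  thus ?thesis using entropy_gap_bound_less by (meson le_less_trans)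
qed

end

theorem theoremB:
  fixes d :: nat and h :: "real set set \<Rightarrow> real"
  assumes "d \<ge> 3"
    and "is_core_entropy d h"
  shows "subtopology (majors_topology d)
           {M \<in> unicritical_majors d. \<forall>M' \<in> unicritical_majors d. h M' \<le> h M}
         homeomorphic_space top_of_set cantor_set"
proof -
  let ?S = "{M \<in> unicritical_majors d. \<forall>M' \<in> unicritical_majors d. h M' \<le> h M}"
  let ?f = "\<lambda>t. {critical_leaf d t}" and ?A = "maximizing_angles d"
  note max = core_entropy_maximizing[OF assms] and not_max = core_entropy_not_maximizing[OF assms]
  note sub = maximizing_angles_subset_circle[OF assms(1)]
  have d: "d \<ge> 2" "d > 0" using assms(1) by simp_all
  have le: "h (?f t) \<le> ln 2" if "t \<in> circle" for t
    using max[of t] not_max[OF that] by (cases "t \<in> ?A") auto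
  have "1 / (real d) \<in> ?A"
    unfolding maximizing_angles_def using assms(1) one_in_nonzero_digits[OF assms(1)]
    by (intro UN_I[of 0] image_eqI[of _ _ 1]) auto
  then obtain a where a: "a \<in> ?A" by blast
  have S: "?S = ?f ` ?A"
  proof (intro equalityI subsetI)
    fix M assume M: "M \<in> ?S"
    then obtain t where t: "t \<in> circle" "M = ?f t" unfolding unicritical_majors_eq[OF d(1)] by blast
    have "h (?f a) \<le> h M" using M a sub unfolding unicritical_majors_eq[OF d(1)] by blast
    hence "t \<in> ?A" using not_max[OF t(1)] max[OF a] t(2) by fastforce
    thus "M \<in> ?f ` ?A" using t(2) by blast
  next
    fix M assume "M \<in> ?f ` ?A"
    then obtain t where t: "t \<in> ?A" "M = ?f t" by blast
    thus "M \<in> ?S"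
      using sub le max[OF t(1)] unfolding unicritical_majors_eq[OF d(1)] by auto
  qed
  have "continuous_map (top_of_set ?A) (majors_topology d) ?f"
    using continuous_map_from_subtopology_mono[OF continuous_map_critical_leaf[OF d(1)] sub] .
  hence cont: "continuous_map (top_of_set ?A) (subtopology (majors_topology d) ?S) ?f"
    unfolding S continuous_map_in_subtopology by auto
  have haus: "Hausdorff_space (majors_topology d)"
    unfolding majors_topology_def
    by (rule Metric_space.Hausdorff_space_mtopology[OF Metric_space_primitive_majors])
  have top: "topspace (majors_topology d) = primitive_majors d"
    unfolding majors_topology_def
    by (rule Metric_space.topspace_mtopology[OF Metric_space_primitive_majors])
  have inj: "inj_on ?f ?A"
  proof (rule inj_onI)
    fix s t assume "s \<in> ?A" "t \<in> ?A" "?f s = ?f t"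
    thus "s = t"
      using leaf_image_critical_leaf[OF d(2), of s] leaf_image_critical_leaf[OF d(2), of t] sub by auto
  qed
  have "homeomorphic_map (top_of_set ?A) (subtopology (majors_topology d) ?S) ?f"
  proof (rule continuous_imp_homeomorphic_map[OF cont])
    show "compact_space (top_of_set ?A)"
      using compact_maximizing_angles[OF assms(1)] by (simp add: compact_space_subtopology)
    show "Hausdorff_space (subtopology (majors_topology d) ?S)"
      using haus by (rule Hausdorff_space_subtopology)
    have "?S \<subseteq> primitive_majors d" by (auto simp: unicritical_majors_def)
    thus "?f ` topspace (top_of_set ?A) = topspace (subtopology (majors_topology d) ?S)"
      using S top by (simp add: inf.absorb2)
  qed (use inj in simp)
  hence "top_of_set ?A homeomorphic_space subtopology (majors_topology d) ?S"
    by (rule homeomorphic_map_imp_homeomorphic_space)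
  hence "subtopology (majors_topology d) ?S homeomorphic_space top_of_set ?A"
    by (rule homeomorphic_space_sym[THEN iffD1])
  also have "top_of_set ?A homeomorphic_space binary_sequences"
    using binary_sequences_homeomorphic_maximizing_angles[OF assms(1)]
    by (rule homeomorphic_space_sym[THEN iffD1])
  also have "binary_sequences homeomorphic_space top_of_set cantor_set"
    by (rule binary_sequences_homeomorphic_cantor_set)
  finally show ?thesis .
qed

end
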